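(* Let $\mathcal{Z} \subseteq \mathbb{R}^2$ be the set of all real points $(q,v)$ such that $Z_G(q,v)=0$ for some finite graph $G$. Then $\mathcal{Z}$ is dense in each of the following regions of the $(q,v)$ plane: (a) $q<0$ and $v<-2$; (b) $q<0$ and $0<v<-q/2$; (c) $0<q\le 32/27$ and $v<v^-_\lozenge(q)$; (d) $0<q\le 32/27$ and $v^+_\lozenge(q)<v<0$; (e) $32/27<q<4$ and $v<0$; (f) $q>4$ and $-q<v<0$.
   Context: Graphs may have loops and multiple edges. For a graph $G=(V,E)$, its Tutte polynomial (random cluster formulation) is $Z_G(q,v)=\sum_{A\subseteq E} q^{k(A)} v^{|A|}$, where $k(A)$ is the number of connected components of the spanning subgraph $(V,A)$. For $0<q<32/27$, $v^+_\lozenge(q)$ denotes the function describing the middle branch of the real curve $v^3-2qv-q^2=0$, and $v^-_\lozenge(q)=q/v^+_\lozenge(q)$. *)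

theory Defs
  imports "HOL-Analysis.Analysis" "HOL-Computational_Algebra.Polynomial"
begin

(* Undirected graphs with loops and multiple edges: edges are named objects, and
   ends e is the one-element (loop) or two-element set of end vertices of e. *)
record ('v, 'e) multigraph =
  verts :: "'v set"
  edges :: "'e set"
  ends :: "'e \<Rightarrow> 'v set"

definition finite_multigraph :: "('v, 'e) multigraph \<Rightarrow> bool" where
  "finite_multigraph G \<longleftrightarrow>
     finite (verts G) \<and> finite (edges G) \<and>
     (\<forall>e \<in> edges G. \<exists>u \<in> verts G. \<exists>w \<in> verts G. ends G e = {u, w})"

definition adjacency :: "('v, 'e) multigraph \<Rightarrow> 'e set \<Rightarrow> ('v \<times> 'v) set" where
  "adjacency G A = {(u, w). \<exists>e \<in> A. ends G e = {u, w}}"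

definition components :: "('v, 'e) multigraph \<Rightarrow> 'e set \<Rightarrow> 'v set set" where
  "components G A = verts G // ((adjacency G A)\<^sup>* \<inter> verts G \<times> verts G)"

definition tutte_Z :: "('v, 'e) multigraph \<Rightarrow> real \<Rightarrow> real \<Rightarrow> real" where
  "tutte_Z G q v = (\<Sum>A \<in> Pow (edges G). q ^ card (components G A) * v ^ card A)"

(* Every finite graph is isomorphic to one whose vertices and edges are natural numbers. *)
definition tutte_zeros :: "(real \<times> real) set" where
  "tutte_zeros = {(q, v). \<exists>G :: (nat, nat) multigraph. finite_multigraph G \<and> tutte_Z G q v = 0}"

(* The polynomial v^3 - 2 q v - q^2 in v, coefficients in ascending order. *)
definition diamond_poly :: "real \<Rightarrow> real poly" where
  "diamond_poly q = [:- (q ^ 2), - 2 * q, 0, 1:]"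

(* Middle branch: the middle one of the three real roots, listed in increasing order with
   multiplicity.  The roots are simple for 0 < q < 32/27; counting multiplicity extends
   the branch continuously to q = 32/27, where it meets the lowest branch at v = -8/9.
   For other q the value is irrelevant. *)
definition v_diamond_plus :: "real \<Rightarrow> real" where
  "v_diamond_plus q = sorted_list_of_multiset (proots (diamond_poly q)) ! 1"

definition v_diamond_minus :: "real \<Rightarrow> real" where
  "v_diamond_minus q = q / v_diamond_plus q"

definition dense_in_region :: "'a::topological_space set \<Rightarrow> 'a set \<Rightarrow> bool" where
  "dense_in_region Z R \<longleftrightarrow> R \<subseteq> closure (Z \<inter> R)"

lemma v_diamond_plus_eqI:
  assumes "diamond_poly q = [:- a, 1:] * ([:- b, 1:] * [:- c, 1:])" "a \<le> b" "b \<le> c"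
  shows "v_diamond_plus q = b"
proof -
  have "proots (diamond_poly q) = mset [a, b, c]"
    unfolding assms(1)
    by (simp add: proots_mult del: mult_pCons_left mult_pCons_right)
  moreover have "sorted_list_of_multiset (mset [a, b, c]) = [a, b, c]"
    using assms(2,3) unfolding sorted_list_of_multiset_mset
    by (intro sorted_sort_id) auto
  ultimately show ?thesis
    by (simp add: v_diamond_plus_def)
qed

lemma diamond_poly_factor:
  assumes "0 < q" "q \<le> 32 / 27"
  obtains a b c where "diamond_poly q = [:- a, 1:] * ([:- b, 1:] * [:- c, 1:])"
    "a \<le> b" "b < 0" "0 < c"
proof -
  let ?p = "\<lambda>v::real. v ^ 3 - 2 * q * v - q ^ 2"
  define s where "s = sqrt (2 * q / 3)"
  have s2: "s ^ 2 = 2 * q / 3" and s0: "0 < s"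
    using assms by (auto simp: s_def)
  have "(3 * q / 4) ^ 2 \<le> s ^ 2"
    unfolding s2 using mult_left_mono[OF assms(2), of q] assms(1)
    by (simp add: power2_eq_square field_simps)
  then have s_ge: "3 * q / 4 \<le> s"
    using s0 by (meson less_imp_le power2_le_imp_le)
  have cube: "s ^ 3 = 2 * q / 3 * s"
    using s2 by (simp add: power3_eq_cube power2_eq_square)
  have ps: "0 \<le> ?p (- s)"
  proof -
    have "?p (- s) = q * (4 / 3 * s - q)"
      using cube by (simp add: algebra_simps power2_eq_square)
    also have "\<dots> \<ge> 0"
      using s_ge assms(1) by (intro mult_nonneg_nonneg) auto
    finally show ?thesis .
  qed
  have "\<exists>b. - s \<le> b \<and> b \<le> 0 \<and> ?p b = 0"
    using ps assms s0 by (intro IVT2') (auto intro!: continuous_intros)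
  then obtain b where b: "- s \<le> b" "b \<le> 0" "?p b = 0" by blast
  have "b \<noteq> 0" using b(3) assms(1) by auto
  with b(2) have b0: "b < 0" by simp
  have b_sq: "b ^ 2 \<le> 2 * q / 3"
    unfolding s2[symmetric] using b(1,2) s0 by (intro abs_le_square_iff[THEN iffD1]) auto
  define d where "d = sqrt (8 * q - 3 * b ^ 2)"
  have d2: "d ^ 2 = 8 * q - 3 * b ^ 2"
    using b_sq assms(1) by (simp add: d_def)
  have "(- 3 * b) ^ 2 \<le> d ^ 2"
    using b_sq by (simp add: d2 power_mult_distrib)
  moreover have "0 \<le> d"
    unfolding d_def using b_sq assms(1) by simp
  ultimately have d_ge: "- 3 * b \<le> d"
    by (rule power2_le_imp_le)
  let ?a = "(- b - d) / 2" and ?c = "(- b + d) / 2"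
  have prod: "?a * ?c = b ^ 2 - 2 * q"
  proof -
    have "?a * ?c = (b ^ 2 - d ^ 2) / 4"
      by (simp add: power2_eq_square field_simps)
    then show ?thesis by (simp add: d2)
  qed
  have "[:- ?a, 1:] * ([:- b, 1:] * [:- ?c, 1:]) =
      [:- (b * (?a * ?c)), ?a * ?c - b ^ 2, 0, 1:]"
    by (simp add: power2_eq_square field_simps)
  also have "\<dots> = diamond_poly q"
    unfolding prod diamond_poly_def using b(3)
    by (simp add: power2_eq_square power3_eq_cube algebra_simps)
  finally show ?thesis
    using that[of ?a b ?c] d_ge b0 by auto
qed

lemma v_diamond_plus_root:
  assumes "0 < q" "q \<le> 32 / 27"
  shows "(v_diamond_plus q) ^ 3 - 2 * q * v_diamond_plus q - q ^ 2 = 0"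
    and "v_diamond_plus q < 0"
proof -
  obtain a b c where f: "diamond_poly q = [:- a, 1:] * ([:- b, 1:] * [:- c, 1:])"
    "a \<le> b" "b < 0" "0 < c"
    using diamond_poly_factor[OF assms] .
  have eq: "v_diamond_plus q = b"
    using f by (intro v_diamond_plus_eqI[of q a b c]) auto
  have "poly (diamond_poly q) b = 0"
    unfolding f(1) poly_mult by simp
  then show "(v_diamond_plus q) ^ 3 - 2 * q * v_diamond_plus q - q ^ 2 = 0"
    unfolding eq diamond_poly_def
    by (simp add: power2_eq_square power3_eq_cube algebra_simps)
  show "v_diamond_plus q < 0"
    using eq f(3) by simp
qed

lemma v_diamond_plus_endpoint: "v_diamond_plus (32 / 27) = - 8 / 9"
  by (rule v_diamond_plus_eqI[of _ "- 8 / 9" _ "16 / 9"])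
     (simp_all add: diamond_poly_def power2_eq_square)

end

theory Submission
  imports Defs
begin

text \<open>A two-terminal graph with all edge weights equal to \<open>v\<close> acts like a single edge of some effective
  weight \<open>w\<close>. In the coordinates \<open>x = 1 + q / w\<close> and \<open>y = 1 + w\<close> parallel composition multiplies
  \<open>y\<close> and series composition multiplies \<open>x\<close>, and closing up the graph gives a zero when \<open>x = 0\<close> or
  \<open>y = 0\<close>. If \<open>y < -1\<close> for some graph, then the values \<open>1 + q / (y ^ n - 1)\<close> approach 1 from both
  sides, and their powers sweep across every positive target while \<open>v\<close> varies in a short interval.
  For \<open>q < 1\<close> the target \<open>1 - q\<close> gives a zero; for \<open>q > 1\<close> one needs a second graph with
  \<open>x < 0\<close>, and aims at \<open>(1 - q) / x\<close>. All of this is symmetric under exchanging \<open>x\<close> and \<open>y\<close>.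

  For \<open>0 < q < 2\<close> suitable graphs arise by iterating the diamond operation, whose fixed points form
  the curve \<open>v ^ 3 - 2 * q * v - q\<^sup>2 = 0\<close>. For \<open>q > 2\<close> and \<open>-2 < v < 0\<close> one takes a complete graph
  without an edge, its edges replaced by many parallel edges; this amounts to chromatic polynomials.
  For \<open>2 < q < 4\<close> and \<open>v < - q\<close> one takes the Petersen graph without an edge, its edges replaced by
  long paths; its flow polynomial \<open>(q - 1) (q - 2) (q - 3) (q - 4) (q\<^sup>2 - 5 q + 10)\<close> is there opposite in
  sign to that of the graph without the edge, which is \<open>(q - 1) (q - 2) (q - 3) (q\<^sup>2 - 6 q + 11)\<close>.\<close>

subsection \<open>Multivariate Tutte polynomials by deletion and contraction\<close>

text \<open>A set of contracted edges is recorded as a labelling of the vertices by the least vertex of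
  their component. With this choice of representatives contractions commute as functions.\<close>

definition merge :: "(nat \<Rightarrow> nat) \<Rightarrow> nat \<Rightarrow> nat \<Rightarrow> nat \<Rightarrow> nat" where
  "merge f u w x = (if f x = f u \<or> f x = f w then min (f u) (f w) else f x)"

lemma merge_sym: "merge f u w = merge f w u"
  by (auto simp: merge_def min_def)

lemma merge_ordered: "f u \<le> f w \<Longrightarrow> merge f u w x = (if f x = f w then f u else f x)"
  by (auto simp: merge_def min_def)

lemma merge_commute: "merge (merge f u w) a b = merge (merge f a b) u w"
proof -
  have main: "merge (merge f u w) a b x = merge (merge f a b) u w x"
    if le: "f u \<le> f w" "f a \<le> f b" for u w a b x
    unfolding merge_def[of "merge f u w"] merge_def[of "merge f a b"]
      merge_ordered[of f u w, OF le(1)] merge_ordered[of f a b, OF le(2)]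
    using le by (cases "f w = f b"; cases "f w = f a"; cases "f u = f b"; cases "f a = f u") auto
  have main: "merge (merge f u w) a b = merge (merge f a b) u w"
    if le: "f u \<le> f w" "f a \<le> f b" for u w a b
    using main[OF le] by blast
  show ?thesis
    using main[of u w a b] main[of u w b a] main[of w u a b] main[of w u b a]
    by (metis merge_sym nle_le)
qed

lemma merge_same: "f u = f w \<Longrightarrow> merge f u w = f"
  by (auto simp: merge_def)

lemma merge_ends: "merge f u w u = merge f u w w"
  by (auto simp: merge_def)

lemma merge_eq_iff:
  "merge f u w x = merge f u w y \<longleftrightarrow>
     f x = f y \<or> (f x \<in> {f u, f w} \<and> f y \<in> {f u, f w})"
  by (auto simp: merge_def min_def)

section \<open>Weighted edge lists and deletion-contraction\<close>

type_synonym wedge = "nat \<times> nat \<times> real \<times> real"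

text \<open>An edge carries the weight \<open>a\<close> for its deletion and \<open>b\<close> for
  its contraction, so that the quotient \<open>b / a\<close> need not exist. The labelling
  \<open>f\<close> records the contractions done so far.\<close>

fun wZ :: "real \<Rightarrow> nat \<Rightarrow> (nat \<Rightarrow> nat) \<Rightarrow> wedge list \<Rightarrow> real" where
  "wZ q n f [] = q ^ card (f ` {..<n})"
| "wZ q n f ((u, w, a, b) # es) = a * wZ q n f es + b * wZ q n (merge f u w) es"

lemma Z_swap: "wZ q n f (e1 # e2 # es) = wZ q n f (e2 # e1 # es)"
  by (cases e1; cases e2) (simp add: algebra_simps merge_commute)

lemma Z_move: "wZ q n f (e # es @ fs) = wZ q n f (es @ e # fs)"
proof (induction es arbitrary: f)
  case (Cons d es)
  have "wZ q n f (e # (d # es) @ fs) = wZ q n f (d # e # es @ fs)"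
    using Z_swap by simp
  also have "\<dots> = wZ q n f (d # es @ e # fs)"
    using Cons by (cases d) simp
  finally show ?case by simp
qed simp

lemma Z_append_commute: "wZ q n f (es @ fs) = wZ q n f (fs @ es)"
proof (induction es arbitrary: f)
  case (Cons d es)
  have "wZ q n f ((d # es) @ fs) = wZ q n f (d # fs @ es)"
    using Cons by (cases d) simp
  then show ?case by (simp add: Z_move)
qed simp

definition edges_below :: "nat \<Rightarrow> wedge list \<Rightarrow> bool" where
  "edges_below n es \<longleftrightarrow> (\<forall>(u, w, a, b) \<in> set es. u < n \<and> w < n)"

text \<open>Fixing all numbers from \<open>n\<close> on lets a labelling serve unchanged after
  vertices are added, each of which starts as a component of its own.\<close>

definition labelling :: "nat \<Rightarrow> (nat \<Rightarrow> nat) \<Rightarrow> bool" where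
  "labelling n f \<longleftrightarrow> (\<forall>x<n. f x < n) \<and> (\<forall>x\<ge>n. f x = x)"

lemma edges_below_simps [simp]:
  "edges_below n []"
  "edges_below n ((u, w, a, b) # es) \<longleftrightarrow> u < n \<and> w < n \<and> edges_below n es"
  "edges_below n (es @ fs) \<longleftrightarrow> edges_below n es \<and> edges_below n fs"
  unfolding edges_below_def by (simp_all add: ball_Un)

lemma edges_below_mono: "edges_below n es \<Longrightarrow> n \<le> m \<Longrightarrow> edges_below m es"
  by (auto simp: edges_below_def)

lemma labelling_id: "labelling n id"
  by (simp add: labelling_def)

lemma labelling_merge: "labelling n f \<Longrightarrow> u < n \<Longrightarrow> w < n \<Longrightarrow> labelling n (merge f u w)"
  by (simp add: labelling_def merge_def min_less_iff_disj) auto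

lemma labelling_mono: "labelling n f \<Longrightarrow> n \<le> m \<Longrightarrow> labelling m f"
  unfolding labelling_def by (metis le_trans not_le order_less_le_trans)

section \<open>Gluing a two-terminal graph into a larger graph\<close>

text \<open>The terminals of a two-terminal graph are its vertices 0 and 1. It is glued into another graph
  at the vertices \<open>i\<close> and \<open>j\<close>, its other vertices being numbered from \<open>n\<close> on.\<close>

definition embed :: "nat \<Rightarrow> nat \<Rightarrow> nat \<Rightarrow> nat \<Rightarrow> nat" where
  "embed n i j x = (if x = 0 then i else if x = 1 then j else x - 2 + n)"

definition embed_edges :: "nat \<Rightarrow> nat \<Rightarrow> nat \<Rightarrow> wedge list \<Rightarrow> wedge list" where
  "embed_edges n i j es = map (\<lambda>(u, w, a, b). (embed n i j u, embed n i j w, a, b)) es"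

lemma embed_edges_simps [simp]:
  "embed_edges n i j [] = []"
  "embed_edges n i j ((u, w, a, b) # es) = (embed n i j u, embed n i j w, a, b) # embed_edges n i j es"
  by (auto simp: embed_edges_def)

text \<open>Here \<open>f\<close> labels the surrounding graph and \<open>h\<close> the inserted
  one. Once the terminals have been joined inside, \<open>i\<close> and \<open>j\<close> are
  identified outside as well.\<close>

definition outer_labels :: "nat \<Rightarrow> nat \<Rightarrow> (nat \<Rightarrow> nat) \<Rightarrow> (nat \<Rightarrow> nat) \<Rightarrow> nat \<Rightarrow> nat" where
  "outer_labels i j f h = (if h 1 = 0 then merge f i j else f)"

text \<open>An inner vertex connected to a terminal inherits the outer label of that terminal; all
  other inner labels are shifted beyond the outer ones.\<close>

definition glue :: "nat \<Rightarrow> nat \<Rightarrow> nat \<Rightarrow> (nat \<Rightarrow> nat) \<Rightarrow> (nat \<Rightarrow> nat) \<Rightarrow> nat \<Rightarrow> nat" where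
  "glue n i j f h y =
     (if y < n then outer_labels i j f h y
      else if h (y + 2 - n) < 2 then outer_labels i j f h (embed n i j (h (y + 2 - n)))
      else h (y + 2 - n) - 2 + n)"

text \<open>These properties survive all contractions that start from \<open>id\<close>: labels are
  least representatives, and the label 1 disappears once the terminals are joined.\<close>

definition two_terminal :: "nat \<Rightarrow> (nat \<Rightarrow> nat) \<Rightarrow> bool" where
  "two_terminal k h \<longleftrightarrow> labelling (k + 2) h \<and> (\<forall>x. h x \<le> x) \<and> (h 1 = 0 \<longrightarrow> (\<forall>x. h x \<noteq> 1))"

lemma two_terminal_id: "two_terminal k id"
  by (simp add: two_terminal_def labelling_id)

lemma two_terminal_merge:
  assumes "two_terminal k h" "u < k + 2" "w < k + 2"
  shows "two_terminal k (merge h u w)"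
proof -
  have h: "labelling (k + 2) h" "\<And>x. h x \<le> x"
    using assms(1) by (auto simp: two_terminal_def)
  have h3: "h x \<noteq> 1" if "h 1 = 0" for x
    using assms(1) that by (auto simp: two_terminal_def)
  have le: "merge h u w x \<le> x" for x
    using h(2)[of x] unfolding merge_def by (auto simp: min_def)
  have "merge h u w x \<noteq> 1" if z: "merge h u w 1 = 0" for x
  proof (cases "h 1 = 0")
    case True
    then show ?thesis using h3[of x] h3[of u] h3[of w] by (simp add: merge_def min_def)
  next
    case False
    then have "h 1 = 1" using h(2)[of 1] by linarith
    with z have "(h u = 1 \<or> h w = 1) \<and> min (h u) (h w) = 0"
      by (auto simp: merge_def split: if_splits)
    then have "h u = 1 \<and> h w = 0 \<or> h u = 0 \<and> h w = 1"
      by (metis min_def zero_neq_one)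
    then show ?thesis by (auto simp: merge_def)
  qed
  with le show ?thesis
    using labelling_merge[OF h(1) assms(2,3)] by (auto simp: two_terminal_def)
qed

lemma glue_embed:
  assumes "two_terminal k h" "i < n" "j < n"
  shows "glue n i j f h (embed n i j x) =
    (if h x < 2 then outer_labels i j f h (embed n i j (h x)) else h x - 2 + n)"
proof -
  have le: "h 0 \<le> 0" "h 1 \<le> 1"
    using assms by (auto simp: two_terminal_def)
  consider "x = 0" | "x = 1" | "2 \<le> x" by linarith
  then show ?thesis
  proof cases
    case 3
    then have "\<not> embed n i j x < n" "embed n i j x + 2 - n = x"
      by (auto simp: embed_def)
    then show ?thesis by (simp add: glue_def)
  next
    case 1
    then show ?thesis using le assms by (simp add: glue_def embed_def)
  next
    case 2
    then show ?thesis using le assms merge_ends[of f i j]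
      by (cases "h 1 = 0") (auto simp: glue_def embed_def outer_labels_def )
  qed
qed

text \<open>Least representatives agree on both sides since shifted inner labels exceed all outer
  labels and the shift preserves their order. Only joining the terminals changes the outer
  labels.\<close>

lemma glue_merge:
  assumes h: "two_terminal k h" and n: "i < n" "j < n" and f: "labelling n f"
    and u: "u < k + 2" "w < k + 2"
  shows "merge (glue n i j f h) (embed n i j u) (embed n i j w) = glue n i j f (merge h u w)"
proof -
  have main: "merge (glue n i j f h) (embed n i j u) (embed n i j w) = glue n i j f (merge h u w)"
    if le: "h u \<le> h w" for u w
  proof -
    let ?c = "outer_labels i j f h"
    have c_less: "?c y < n" if "y < n" for y
      using f n that labelling_merge[OF f n] by (auto simp: outer_labels_def labelling_def)
    have emb_less: "embed n i j l < n" if "l < 2" for l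
      using that n by (auto simp: embed_def)
    have h1: "h 1 = 0 \<or> h 1 = 1" "h 0 = 0" and h1z: "h 1 = 0 \<Longrightarrow> h x \<noteq> 1" for x
      using h unfolding two_terminal_def by (auto simp: le_Suc_eq dest: spec[of _ 1])
    have gl: "glue n i j f h (embed n i j x) =
      (if h x < 2 then ?c (embed n i j (h x)) else h x - 2 + n)" for x
      by (rule glue_embed[OF h n])
    \<comment> \<open>The edge closes a cycle, joins the terminals, attaches an inner component to a
      terminal, or joins two inner components.\<close>
    consider "h u = h w" | "h u = 0" "h w = 1" | "h u < 2" "2 \<le> h w" | "2 \<le> h u" "h u < h w"
      using le by linarith
    then show ?thesis
    proof cases
      case 1
      then have "glue n i j f h (embed n i j u) = glue n i j f h (embed n i j w)"
        by (simp add: gl)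
      with 1 show ?thesis by (simp add: merge_same)
    next
      case 2
      then have h11: "h 1 = 1" using h1 h1z by blast
      have c: "?c = f" using h11 by (simp add: outer_labels_def)
      have m1: "merge h u w 1 = 0" using 2 h11 by (simp add: merge_def)
      have c': "outer_labels i j f (merge h u w) = merge f i j" using m1 by (simp add: outer_labels_def)
      have gu: "glue n i j f h (embed n i j u) = f i" "glue n i j f h (embed n i j w) = f j"
        using 2 gl[of u] gl[of w] by (simp_all add: c embed_def)
      have fl: "f i < n" "f j < n" using f n by (auto simp: labelling_def)
      show ?thesis
      proof
        fix y
        show "merge (glue n i j f h) (embed n i j u) (embed n i j w) y = glue n i j f (merge h u w) y"
          unfolding merge_def[of "glue n i j f h"] gu
          using 2 fl unfolding glue_def c c'
          by (auto simp: merge_def embed_def)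
      qed
    next
      case 3
      have c': "outer_labels i j f (merge h u w) = ?c"
      proof -
        have "merge h u w 1 = h 1" using 3 h1 by (auto simp: merge_def)
        then show ?thesis by (simp add: outer_labels_def)
      qed
      have lt: "?c (embed n i j (h u)) < n" using c_less emb_less 3 by blast
      have gu: "glue n i j f h (embed n i j u) = ?c (embed n i j (h u))"
        "glue n i j f h (embed n i j w) = h w - 2 + n"
        using 3 gl[of u] gl[of w] by simp_all
      have gle: "glue n i j f h (embed n i j u) \<le> glue n i j f h (embed n i j w)"
        unfolding gu using lt by linarith
      show ?thesis
      proof
        fix y
        show "merge (glue n i j f h) (embed n i j u) (embed n i j w) y = glue n i j f (merge h u w) y"
          unfolding merge_ordered[of "glue n i j f h", OF gle] gu
          unfolding glue_def c' merge_ordered[of h u w, OF le]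
          using 3 lt
          using c_less[of y] c_less[OF emb_less, of "h (y + 2 - n)"]
          by auto
      qed
    next
      case 4
      have c': "outer_labels i j f (merge h u w) = ?c"
      proof -
        have "merge h u w 1 = h 1" using 4 h1 by (auto simp: merge_def)
        then show ?thesis by (simp add: outer_labels_def)
      qed
      have gu: "glue n i j f h (embed n i j u) = h u - 2 + n"
        "glue n i j f h (embed n i j w) = h w - 2 + n"
        using 4 gl[of u] gl[of w] by simp_all
      have gle: "glue n i j f h (embed n i j u) \<le> glue n i j f h (embed n i j w)"
        unfolding gu using le by linarith
      show ?thesis
      proof
        fix y
        show "merge (glue n i j f h) (embed n i j u) (embed n i j w) y = glue n i j f (merge h u w) y"
          unfolding merge_ordered[of "glue n i j f h", OF gle] gu
          unfolding glue_def c' merge_ordered[of h u w, OF le]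
          using 4
          using c_less[of y] c_less[OF emb_less, of "h (y + 2 - n)"]
          by auto
      qed
    qed
  qed
  show ?thesis
  proof (cases "h u \<le> h w")
    case False
    then show ?thesis using main[of w u] by (simp add: merge_sym[of _ u] merge_sym[of _ "embed n i j u"])
  qed (rule main)
qed

text \<open>With no inner edges left, every inner component away from both terminals stays isolated
  and contributes a factor \<open>q\<close>.\<close>

lemma Z_glue:
  assumes h: "two_terminal k h" and n: "i < n" "j < n"
    and f: "labelling n f" and es: "edges_below n es"
  shows "wZ q (n + k) (glue n i j f h) es =
    q ^ card (h ` {..<k + 2} - {0, 1}) * wZ q n (outer_labels i j f h) es"
  using f es
proof (induction es arbitrary: f)
  case Nil
  let ?c = "outer_labels i j f h" and ?g = "glue n i j f h"
  let ?A = "?c ` {..<n}" and ?L = "h ` {..<k + 2} - {0, 1}"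
  have c_less: "?c y < n" if "y < n" for y
    using Nil n that labelling_merge[of n f i j] by (auto simp: outer_labels_def labelling_def)
  have h01: "h 0 = 0" "h 1 < 2"
    using h unfolding two_terminal_def by (auto simp: less_Suc_eq_le dest: spec[of _ 1])
  have "?g ` {..<n + k} = ?A \<union> (\<lambda>l. l - 2 + n) ` ?L"
  proof (intro equalityI subsetI)
    fix z assume "z \<in> ?g ` {..<n + k}"
    then obtain y where y: "y < n + k" "z = ?g y" by auto
    show "z \<in> ?A \<union> (\<lambda>l. l - 2 + n) ` ?L"
    proof (cases "y < n")
      case True
      then show ?thesis using y by (auto simp: glue_def)
    next
      case F: False
      show ?thesis
      proof (cases "h (y + 2 - n) < 2")
        case True
        then have "embed n i j (h (y + 2 - n)) < n" using n by (auto simp: embed_def)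
        then show ?thesis using y F True by (auto simp: glue_def)
      next
        case False
        have "y + 2 - n < k + 2" using y F by auto
        then show ?thesis using y F False by (auto simp: glue_def image_iff)
      qed
    qed
  next
    fix z assume "z \<in> ?A \<union> (\<lambda>l. l - 2 + n) ` ?L"
    then show "z \<in> ?g ` {..<n + k}"
    proof
      assume "z \<in> ?A"
      then obtain y where "y < n" "z = ?c y" by auto
      then show ?thesis by (intro image_eqI[of _ _ y]) (auto simp: glue_def)
    next
      assume "z \<in> (\<lambda>l. l - 2 + n) ` ?L"
      then obtain x where x: "x < k + 2" "h x \<noteq> 0" "h x \<noteq> 1" "z = h x - 2 + n" by auto
      have "x \<noteq> 0" using x h01 by metis
      moreover have "x \<noteq> 1" using x h01 by (metis One_nat_def less_2_cases)
      ultimately have "x \<ge> 2" by linarith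
      have "h (x - 2 + n + 2 - n) = h x"
        using \<open>x \<ge> 2\<close> by (intro arg_cong[of _ _ h]) linarith
      moreover have "\<not> h x < 2" using x by linarith
      ultimately have "?g (x - 2 + n) = z" using x by (simp add: glue_def)
      moreover have "x - 2 + n < n + k" using x \<open>x \<ge> 2\<close> by linarith
      ultimately show ?thesis by blast
    qed
  qed
  moreover have "?A \<inter> (\<lambda>l. l - 2 + n) ` ?L = {}"
    using c_less by force
  moreover have "card ((\<lambda>l. l - 2 + n) ` ?L) = card ?L"
    by (rule card_image) (auto simp: inj_on_def)
  ultimately have "card (?g ` {..<n + k}) = card ?A + card ?L"
    by (simp add: card_Un_disjoint)
  then show ?case by (simp add: power_add)
next
  case (Cons e es)
  obtain u w a b where e: "e = (u, w, a, b)" by (cases e) auto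
  have uw: "u < n" "w < n" "edges_below n es" using Cons e by auto
  have c: "merge (outer_labels i j f h) u w = outer_labels i j (merge f u w) h"
    by (simp add: outer_labels_def merge_commute)
  have c_less: "outer_labels i j f h y < n" if "y < n" for y
    using Cons n that labelling_merge[of n f i j] by (auto simp: outer_labels_def labelling_def)
  have "merge (glue n i j f h) u w y = glue n i j (merge f u w) h y" for y
  proof -
    let ?c = "outer_labels i j f h"
    have u: "glue n i j f h u = ?c u" "glue n i j f h w = ?c w"
      using uw by (simp_all add: glue_def)
    have y: "glue n i j (merge f u w) h y = (if y < n then merge ?c u w y
      else if h (y + 2 - n) < 2 then merge ?c u w (embed n i j (h (y + 2 - n)))
      else h (y + 2 - n) - 2 + n)"
      unfolding glue_def c ..
    consider "y < n" | "\<not> y < n" "h (y + 2 - n) < 2" | "\<not> y < n" "\<not> h (y + 2 - n) < 2" by blast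
    then show ?thesis
    proof cases
      case 3
      then have "glue n i j f h y = h (y + 2 - n) - 2 + n" by (simp add: glue_def)
      moreover have "h (y + 2 - n) - 2 + n \<noteq> ?c u" "h (y + 2 - n) - 2 + n \<noteq> ?c w"
        using c_less[OF uw(1)] c_less[OF uw(2)] by linarith+
      ultimately have "merge (glue n i j f h) u w y = h (y + 2 - n) - 2 + n"
        unfolding merge_def u by simp
      then show ?thesis unfolding y using 3 by simp
    qed (simp_all only: y merge_def u, simp_all add: glue_def)
  qed
  then have "merge (glue n i j f h) u w = glue n i j (merge f u w) h" by blast
  moreover have "labelling n (merge f u w)" using Cons uw labelling_merge by auto
  ultimately show ?case
    using Cons.IH[OF Cons.prems(1)] Cons.IH[of "merge f u w"] uw
    by (simp add: e c algebra_simps)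
qed

text \<open>\<open>\<alpha>\<close> collects the inner edge sets that leave the terminals separate,
  \<open>\<beta>\<close> those that join them. Both are fixed before the outer data, so that two
  test graphs can determine them later.\<close>

lemma two_terminal_expand_aux:
  assumes "two_terminal k h" "edges_below (k + 2) g"
  shows "\<exists>\<alpha> \<beta>. \<forall>n i j f es. i < n \<longrightarrow> j < n \<longrightarrow> labelling n f \<longrightarrow> edges_below n es \<longrightarrow>
    wZ q (n + k) (glue n i j f h) (embed_edges n i j g @ es) =
      \<alpha> * wZ q n f es + \<beta> * wZ q n (merge f i j) es"
  using assms
proof (induction g arbitrary: h)
  case Nil
  define c where "c = q ^ card (h ` {..<k + 2} - {0, 1})"
  show ?case
  proof (cases "h 1 = 0")
    case True
    show ?thesis
      by (rule exI[of _ 0], rule exI[of _ c])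
         (use Z_glue[OF Nil(1)] True in \<open>simp add: outer_labels_def c_def\<close>)
  next
    case False
    show ?thesis
      by (rule exI[of _ c], rule exI[of _ 0])
         (use Z_glue[OF Nil(1)] False in \<open>simp add: outer_labels_def c_def\<close>)
  qed
next
  case (Cons e g)
  obtain u w a b where e: "e = (u, w, a, b)" by (cases e) auto
  have uw: "u < k + 2" "w < k + 2" "edges_below (k + 2) g" using Cons e by auto
  obtain \<alpha>1 \<beta>1 where 1: "\<And>n i j f es. i < n \<Longrightarrow> j < n \<Longrightarrow> labelling n f \<Longrightarrow> edges_below n es \<Longrightarrow>
    wZ q (n + k) (glue n i j f h) (embed_edges n i j g @ es) =
      \<alpha>1 * wZ q n f es + \<beta>1 * wZ q n (merge f i j) es"
    using Cons.IH[OF Cons.prems(1) uw(3)] by blast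
  obtain \<alpha>2 \<beta>2 where 2: "\<And>n i j f es. i < n \<Longrightarrow> j < n \<Longrightarrow> labelling n f \<Longrightarrow> edges_below n es \<Longrightarrow>
    wZ q (n + k) (glue n i j f (merge h u w)) (embed_edges n i j g @ es) =
      \<alpha>2 * wZ q n f es + \<beta>2 * wZ q n (merge f i j) es"
    using Cons.IH[OF two_terminal_merge[OF Cons.prems(1) uw(1,2)] uw(3)] by blast
  show ?case
    apply (rule exI[of _ "a * \<alpha>1 + b * \<alpha>2"], rule exI[of _ "a * \<beta>1 + b * \<beta>2"])
    using 1 2 glue_merge[OF Cons.prems(1) _ _ _ uw(1,2)]
    by (simp add: e algebra_simps)
qed

text \<open>The test graphs are two vertices without edges, distinct or identified. They give
  \<open>T = \<alpha> * q\<^sup>2 + \<beta> * q\<close> and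
  \<open>M = \<alpha> * q + \<beta> * q\<close>, a system that is regular for \<open>q\<close> other
  than 0 and 1.\<close>

lemma two_terminal_expand:
  assumes "edges_below (k + 2) g" and q: "q \<noteq> 0" "q \<noteq> 1"
    and i: "i < n" "j < n" and f: "labelling n f" and es: "edges_below n es"
  defines "T \<equiv> wZ q (k + 2) id g" and "M \<equiv> wZ q (k + 2) (merge id 0 1) g"
  shows "wZ q (n + k) f (embed_edges n i j g @ es) =
    (T - M) / (q * (q - 1)) * wZ q n f es + (q * M - T) / (q * (q - 1)) * wZ q n (merge f i j) es"
proof -
  have glue_id: "glue n i j f id = f" if "labelling n f" for n i j f
    using that by (intro ext) (auto simp: glue_def outer_labels_def labelling_def)
  obtain \<alpha> \<beta> where ab: "\<And>n i j f es. i < n \<Longrightarrow> j < n \<Longrightarrow> labelling n f \<Longrightarrow> edges_below n es \<Longrightarrow>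
    wZ q (n + k) f (embed_edges n i j g @ es) = \<alpha> * wZ q n f es + \<beta> * wZ q n (merge f i j) es"
    using two_terminal_expand_aux[OF two_terminal_id assms(1), of q] glue_id by metis
  have emb: "embed_edges 2 0 1 g = g" for g
  proof (induction g)
    case (Cons e g)
    moreover have "embed 2 0 1 x = x" for x by (auto simp: embed_def)
    ultimately show ?case by (cases e) simp
  qed simp
  have l2: "labelling 2 (merge id 0 1)" by (rule labelling_merge[OF labelling_id]) auto
  have c1: "{..<2::nat} = {0, 1}" by auto
  have m: "merge (merge id 0 1) 0 1 = merge id 0 1"
    by (rule merge_same) (simp add: merge_def)
  have Zm: "wZ q 2 (merge id 0 1) [] = q"
    by (simp add: c1 merge_def)
  have "T = \<alpha> * q\<^sup>2 + \<beta> * q"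
    using ab[of 0 2 1 id "[]"] emb[of g] Zm
    by (simp add: T_def labelling_id add.commute card_insert_if)
  moreover have "M = \<alpha> * q + \<beta> * q"
    using ab[of 0 2 1 "merge id 0 1" "[]"] emb[of g] Zm l2 m
    by (simp add: M_def add.commute)
  ultimately have "\<alpha> = (T - M) / (q * (q - 1))" "\<beta> = (q * M - T) / (q * (q - 1))"
    using q by (simp_all add: field_simps power2_eq_square)
  then show ?thesis using ab[OF i f es] by simp
qed

subsection \<open>Two-terminal graphs and effective weights\<close>

definition plain_edges :: "real \<Rightarrow> (nat \<times> nat) list \<Rightarrow> wedge list" where
  "plain_edges v L = map (\<lambda>(u, w). (u, w, 1, v)) L"

lemma plain_edges_simps [simp]:
  "plain_edges v [] = []"
  "plain_edges v ((u, w) # L) = (u, w, 1, v) # plain_edges v L"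
  "plain_edges v (L @ L') = plain_edges v L @ plain_edges v L'"
  by (auto simp: plain_edges_def)

text \<open>Edges are numbered from the end of the list, so that adding an edge at the front keeps the
  numbers of the others.\<close>

definition edge_at :: "(nat \<times> nat) list \<Rightarrow> nat \<Rightarrow> nat \<times> nat" where
  "edge_at L e = L ! (length L - 1 - e)"

definition graph_of :: "nat \<Rightarrow> (nat \<times> nat) list \<Rightarrow> (nat, nat) multigraph" where
  "graph_of n L = \<lparr>verts = {..<n}, edges = {..<length L},
     ends = (\<lambda>e. {fst (edge_at L e), snd (edge_at L e)})\<rparr>"

fun merges :: "(nat \<Rightarrow> nat) \<Rightarrow> (nat \<times> nat) list \<Rightarrow> nat set \<Rightarrow> nat \<Rightarrow> nat" where
  "merges f [] A = f"
| "merges f ((u, w) # L) A = merges (if length L \<in> A then merge f u w else f) L A"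

lemma merges_insert_top: "length L \<le> m \<Longrightarrow> merges f L (insert m A) = merges f L A"
  by (induction f L A rule: merges.induct) auto

text \<open>Deleting or contracting the first edge splits the sum according to whether the edge set
  contains the highest index \<open>length L\<close>.\<close>

lemma Z_plain_edges:
  "wZ q n f (plain_edges v L) =
     (\<Sum>A\<in>Pow {..<length L}. q ^ card (merges f L A ` {..<n}) * v ^ card A)"
proof (induction L arbitrary: f)
  case (Cons e L)
  obtain u w where e: "e = (u, w)" by (cases e)
  let ?P = "Pow {..<length L}" and ?m = "length L"
  let ?t = "\<lambda>A. q ^ card (merges f (e # L) A ` {..<n}) * v ^ card A"
  have "Pow {..<length (e # L)} = ?P \<union> insert ?m ` ?P"
    by (simp add: lessThan_Suc Pow_insert)
  moreover have "?P \<inter> insert ?m ` ?P = {}" by auto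
  ultimately have "(\<Sum>A\<in>Pow {..<length (e # L)}. ?t A) = sum ?t ?P + sum ?t (insert ?m ` ?P)"
    by (simp add: sum.union_disjoint)
  also have "sum ?t ?P = wZ q n f (plain_edges v L)"
    unfolding Cons by (rule sum.cong) (auto simp: e)
  also have "sum ?t (insert ?m ` ?P) = sum (?t \<circ> insert ?m) ?P"
  proof (rule sum.reindex, rule inj_onI)
    fix A B assume "A \<in> ?P" "B \<in> ?P" "insert ?m A = insert ?m B"
    moreover from this have "?m \<notin> A" "?m \<notin> B" by auto
    ultimately show "A = B" by (simp add: insert_ident)
  qed
  also have "\<dots> = v * wZ q n (merge f u w) (plain_edges v L)"
    unfolding Cons sum_distrib_left
  proof (rule sum.cong)
    fix A assume A: "A \<in> ?P"
    then have "finite A" "?m \<notin> A" by (auto intro: finite_subset)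
    then show "(?t \<circ> insert ?m) A =
        v * (q ^ card (merges (merge f u w) L A ` {..<n}) * v ^ card A)"
      by (simp add: e merges_insert_top)
  qed simp
  finally show ?case by (simp add: e)
qed simp

text \<open>This translates labels into the reflexive transitive closures by which components are
  defined.\<close>

lemma kernel_merge:
  "{(x, y). merge f u w x = merge f u w y} = ({(x, y). f x = f y} \<union> {(u, w), (w, u)})\<^sup>*"
  (is "?K = ?R\<^sup>*")
proof
  show "?R\<^sup>* \<subseteq> ?K"
  proof clarify
    fix x y assume "(x, y) \<in> ?R\<^sup>*"
    then show "merge f u w x = merge f u w y"
      by (induction rule: rtrancl_induct) (auto simp: merge_eq_iff)
  qed
next
  show "?K \<subseteq> ?R\<^sup>*"
  proof clarify
    fix x y assume *: "merge f u w x = merge f u w y"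
    have s: "(a, b) \<in> ?R\<^sup>*" if "f a = f b" for a b using that by auto
    have uw: "(u, w) \<in> ?R\<^sup>*" "(w, u) \<in> ?R\<^sup>*" by auto
    from * consider "f x = f y" | "f x = f u" "f y = f w" | "f x = f w" "f y = f u"
      unfolding merge_eq_iff by fastforce
    then show "(x, y) \<in> ?R\<^sup>*"
    proof cases
      case 2
      then show ?thesis using s[of x u] s[of w y] uw by (metis rtrancl_trans)
    next
      case 3
      then show ?thesis using s[of x w] s[of u y] uw by (metis rtrancl_trans)
    qed (rule s)
  qed
qed

lemma kernel_merges:
  "{(x, y). merges f L A x = merges f L A y} =
     ({(x, y). f x = f y} \<union>
      {(x, y). \<exists>e\<in>A. e < length L \<and> {fst (edge_at L e), snd (edge_at L e)} = {x, y}})\<^sup>*"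
proof (induction L arbitrary: f)
  case Nil
  have "f x = f y" if "(x, y) \<in> {(x, y). f x = f y}\<^sup>*" for x y
    using that by (induction rule: rtrancl_induct) auto
  then have "{(x, y). f x = f y}\<^sup>* \<subseteq> {(x, y). f x = f y}" by blast
  then have "{(x, y). f x = f y}\<^sup>* = {(x, y). f x = f y}"
    by (rule subset_antisym) (rule r_into_rtrancl[THEN subrelI])
  then show ?case by simp
next
  case (Cons e L)
  obtain u w where e: "e = (u, w)" by (cases e)
  let ?E = "\<lambda>L. {(x, y). \<exists>e\<in>A. e < length L \<and> {fst (edge_at L e), snd (edge_at L e)} = {x, y}}"
  have at: "edge_at (e # L) i = edge_at L i" if "i < length L" for i
    using that by (simp add: edge_at_def nth_Cons')
  have top: "edge_at (e # L) (length L) = e" by (simp add: edge_at_def)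
  have ex: "(\<exists>i\<in>A. i < length (e # L) \<and> P (edge_at (e # L) i)) \<longleftrightarrow>
      (\<exists>i\<in>A. i < length L \<and> P (edge_at L i)) \<or> length L \<in> A \<and> P e" for P
    using at top by (metis length_Cons less_Suc_eq)
  have ends: "(\<exists>i\<in>A. i < length (e # L) \<and>
        {fst (edge_at (e # L) i), snd (edge_at (e # L) i)} = {x, y}) \<longleftrightarrow>
      (\<exists>i\<in>A. i < length L \<and> {fst (edge_at L i), snd (edge_at L i)} = {x, y}) \<or>
      length L \<in> A \<and> {fst e, snd e} = {x, y}" for x y
    by (rule ex)
  let ?K = "\<lambda>f. {(x, y). f x = f y}"
  show ?case
  proof (cases "length L \<in> A")
    case False
    then have "?E (e # L) = ?E L"
      by (simp only: ends) simp
    then show ?thesis using Cons[of f] False by (simp add: e)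
  next
    case True
    then have E: "?E (e # L) = ?E L \<union> {(u, w), (w, u)}"
      by (simp only: ends) (auto simp: e doubleton_eq_iff)
    have "?K (merges f (e # L) A) = (?K (merge f u w) \<union> ?E L)\<^sup>*"
      using Cons[of "merge f u w"] True by (simp add: e)
    also have "\<dots> = (?K f \<union> {(u, w), (w, u)} \<union> ?E L)\<^sup>*"
      unfolding kernel_merge by (subst (1 2) rtrancl_Un_rtrancl[symmetric]) simp
    finally show ?thesis unfolding E by (simp add: Un_ac)
  qed
qed

text \<open>The classes are the nonempty fibres of \<open>g\<close> on \<open>V\<close>, one for
  each value.\<close>

lemma card_quotient_kernel:
  "card (V // ({(x, y). g x = g y} \<inter> V \<times> V)) = card (g ` V)"
proof -
  have "V // ({(x, y). g x = g y} \<inter> V \<times> V) = (\<lambda>l. {y \<in> V. g y = l}) ` (g ` V)"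
  proof -
    have "({(x, y). g x = g y} \<inter> V \<times> V) `` {x} = {y \<in> V. g y = g x}" if "x \<in> V" for x
      using that by auto
    then show ?thesis unfolding quotient_def image_image by auto
  qed
  moreover have "inj_on (\<lambda>l. {y \<in> V. g y = l}) (g ` V)"
    by (auto simp: inj_on_def)
  ultimately show ?thesis by (simp add: card_image)
qed

lemma tutte_Z_graph_of: "tutte_Z (graph_of n L) q v = wZ q n id (plain_edges v L)"
proof -
  have "components (graph_of n L) A =
      {..<n} // ({(x, y). merges id L A x = merges id L A y} \<inter> {..<n} \<times> {..<n})"
    if "A \<subseteq> {..<length L}" for A
  proof -
    let ?E = "{(x, y). \<exists>e\<in>A. e < length L \<and> {fst (edge_at L e), snd (edge_at L e)} = {x, y}}"
    have "?E = adjacency (graph_of n L) A"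
      using that by (auto simp: adjacency_def graph_of_def)
    moreover have "{(x, y). id x = id y} = (Id :: (nat \<times> nat) set)" by auto
    ultimately have "{(x, y). merges id L A x = merges id L A y} = (adjacency (graph_of n L) A)\<^sup>*"
      unfolding kernel_merges by (metis Un_commute rtrancl_reflcl)
    then show ?thesis by (simp add: components_def graph_of_def)
  qed
  then show ?thesis
    unfolding tutte_Z_def Z_plain_edges
    by (intro sum.cong) (auto simp: graph_of_def card_quotient_kernel)
qed

definition pairs_below :: "nat \<Rightarrow> (nat \<times> nat) list \<Rightarrow> bool" where
  "pairs_below n L \<longleftrightarrow> (\<forall>(u, w) \<in> set L. u < n \<and> w < n)"

lemma tutte_zerosI:
  assumes "pairs_below n L" "wZ q n id (plain_edges v L) = 0"
  shows "(q, v) \<in> tutte_zeros"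
proof -
  have "finite_multigraph (graph_of n L)"
    unfolding finite_multigraph_def
  proof (intro conjI ballI)
    fix e assume "e \<in> edges (graph_of n L)"
    then have "edge_at L e \<in> set L" by (auto simp: graph_of_def edge_at_def)
    then have "fst (edge_at L e) < n \<and> snd (edge_at L e) < n"
      using assms(1) by (auto simp: pairs_below_def)
    then show "\<exists>u\<in>verts (graph_of n L). \<exists>w\<in>verts (graph_of n L). ends (graph_of n L) e = {u, w}"
      by (auto simp: graph_of_def)
  qed (auto simp: graph_of_def)
  then show ?thesis
    unfolding tutte_zeros_def using assms(2) tutte_Z_graph_of[of n L q v] by auto
qed

section \<open>Gadgets and their substitution for edges\<close>

text \<open>A two-terminal graph with effective weight \<open>b v / a v\<close>, in homogeneous form to avoid division.
  At \<open>v = 0\<close> the weight is 0; hence it is not constant on any interval on which it is nonzero.\<close>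

definition gadget :: "real \<Rightarrow> (real \<Rightarrow> real) \<Rightarrow> (real \<Rightarrow> real) \<Rightarrow> bool" where
  "gadget q a b \<longleftrightarrow>
     real_polynomial_function a \<and> real_polynomial_function b \<and> a 0 \<noteq> 0 \<and> b 0 = 0 \<and>
     (\<forall>v n i j. i < n \<longrightarrow> j < n \<longrightarrow>
       (\<exists>m L. n \<le> m \<and> pairs_below m L \<and>
         (\<forall>f es. labelling n f \<longrightarrow> edges_below n es \<longrightarrow>
           wZ q m f (plain_edges v L @ es) = a v * wZ q n f es + b v * wZ q n (merge f i j) es)))"

lemma gadget_edge: "gadget q (\<lambda>v. 1) (\<lambda>v. v)"
  unfolding gadget_def
proof (intro conjI allI impI)
  fix v n i j assume "i < n" "j < (n::nat)"
  then show "\<exists>m L. n \<le> m \<and> pairs_below m L \<and>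
         (\<forall>f es. labelling n f \<longrightarrow> edges_below n es \<longrightarrow>
           wZ q m f (plain_edges v L @ es) = 1 * wZ q n f es + v * wZ q n (merge f i j) es)"
    by (intro exI[of _ n] exI[of _ "[(i, j)]"]) (simp add: pairs_below_def)
qed (auto intro: real_polynomial_function.intros)

text \<open>There are two ways of closing up: between two isolated vertices the polynomial is
  \<open>q * (q * a v + b v)\<close>, with both terminals at one vertex it is
  \<open>q * (a v + b v)\<close>.\<close>

lemma tutte_zeros_gadget:
  assumes "gadget q a b" "q * a v + b v = 0 \<or> a v + b v = 0"
  shows "(q, v) \<in> tutte_zeros"
proof -
  have g: "\<exists>m L. pairs_below m L \<and> wZ q m id (plain_edges v L) = a v * wZ q n id [] + b v * wZ q n (merge id i j) []"
    if "i < n" "j < n" for n i j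
    using assms(1) that labelling_id[of n] unfolding gadget_def
    by (metis append_Nil2 edges_below_simps(1))
  show ?thesis
    using assms(2)
  proof
    assume z: "q * a v + b v = 0"
    have "{..<2::nat} = {0, 1}" by auto
    then have "a v * wZ q 2 id [] + b v * wZ q 2 (merge id 0 1) [] = q * (q * a v + b v)"
      by (simp add: merge_def power2_eq_square algebra_simps card_insert_if)
    then show ?thesis using g[of 0 2 1] z tutte_zerosI by auto
  next
    assume z: "a v + b v = 0"
    have "{..<1::nat} = {0}" by auto
    then have "a v * wZ q 1 id [] + b v * wZ q 1 (merge id 0 0) [] = q * (a v + b v)"
      by (simp add: merge_def algebra_simps)
    then show ?thesis using g[of 0 1 0] z tutte_zerosI by auto
  qed
qed

type_synonym gedge = "nat \<times> nat \<times> (real \<Rightarrow> real) \<times> (real \<Rightarrow> real)"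

definition eval_edges :: "real \<Rightarrow> gedge list \<Rightarrow> wedge list" where
  "eval_edges v gs = map (\<lambda>(u, w, a, b). (u, w, a v, b v)) gs"

lemma eval_edges_simps [simp]:
  "eval_edges v [] = []"
  "eval_edges v ((u, w, a, b) # gs) = (u, w, a v, b v) # eval_edges v gs"
  by (auto simp: eval_edges_def)

definition gadget_edges :: "real \<Rightarrow> nat \<Rightarrow> gedge list \<Rightarrow> bool" where
  "gadget_edges q n gs \<longleftrightarrow> (\<forall>(u, w, a, b) \<in> set gs. u < n \<and> w < n \<and> gadget q a b)"

lemma gadget_edges_simps [simp]:
  "gadget_edges q n []"
  "gadget_edges q n ((u, w, a, b) # gs) \<longleftrightarrow> u < n \<and> w < n \<and> gadget q a b \<and> gadget_edges q n gs"
  by (auto simp: gadget_edges_def)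

lemma gadget_edges_below: "gadget_edges q n gs \<Longrightarrow> edges_below n (eval_edges v gs)"
  by (induction gs) auto

lemma pairs_below_append [simp]:
  "pairs_below n (L @ L') \<longleftrightarrow> pairs_below n L \<and> pairs_below n L'"
  unfolding pairs_below_def by (simp add: ball_Un)

lemma pairs_below_edges: "pairs_below n L \<Longrightarrow> edges_below n (plain_edges v L)"
  by (auto simp: pairs_below_def edges_below_def plain_edges_def)

lemma pairs_below_mono: "pairs_below n L \<Longrightarrow> n \<le> m \<Longrightarrow> pairs_below m L"
  by (auto simp: pairs_below_def)

text \<open>The gadgets are expanded one after another; inner vertices of those already expanded
  count as outer vertices for the next.\<close>

lemma expand_gadgets:
  assumes "gadget_edges q n gs"
  shows "\<exists>m L. n \<le> m \<and> pairs_below m L \<and>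
    (\<forall>f es. labelling n f \<longrightarrow> edges_below n es \<longrightarrow>
      wZ q m f (plain_edges v L @ es) = wZ q n f (eval_edges v gs @ es))"
  using assms
proof (induction gs)
  case Nil
  show ?case by (intro exI[of _ n] exI[of _ "[]"]) (simp add: pairs_below_def)
next
  case (Cons g gs)
  obtain u w a b where g: "g = (u, w, a, b)" by (cases g) auto
  have uw: "u < n" "w < n" "gadget q a b" "gadget_edges q n gs" using Cons g by auto
  obtain m L where m: "n \<le> m" "pairs_below m L"
    "\<And>f es. labelling n f \<Longrightarrow> edges_below n es \<Longrightarrow>
      wZ q m f (plain_edges v L @ es) = wZ q n f (eval_edges v gs @ es)"
    using Cons.IH[OF uw(4)] by blast
  obtain m' L' where m': "m \<le> m'" "pairs_below m' L'"
    "\<And>f es. labelling m f \<Longrightarrow> edges_below m es \<Longrightarrow>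
      wZ q m' f (plain_edges v L' @ es) = a v * wZ q m f es + b v * wZ q m (merge f u w) es"
    using uw m(1) unfolding gadget_def by (meson less_le_trans)
  have "wZ q m' f (plain_edges v (L' @ L) @ es) = wZ q n f (eval_edges v (g # gs) @ es)"
    if fe: "labelling n f" "edges_below n es" for f es
    using m'(3)[of f "plain_edges v L @ es"] m(3)[OF fe]
      m(3)[OF labelling_merge[OF fe(1) uw(1,2)] fe(2)] labelling_mono[OF fe(1) m(1)]
      edges_below_mono[OF fe(2) m(1)] pairs_below_edges[OF m(2)]
    by (simp add: g)
  moreover have "pairs_below m' (L' @ L)" using m m' pairs_below_mono by auto
  ultimately show ?case using m(1) m'(1) by (meson le_trans)
qed

lemma polynomial_Z:
  "gadget_edges q N gs \<Longrightarrow> real_polynomial_function (\<lambda>v. wZ q n f (eval_edges v gs))"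
proof (induction gs arbitrary: f)
  case (Cons g gs)
  obtain u w a b where g: "g = (u, w, a, b)" by (cases g) auto
  then have "real_polynomial_function a" "real_polynomial_function b" "gadget_edges q N gs"
    using Cons.prems by (auto simp: gadget_def)
  with Cons.IH show ?case by (simp add: g real_polynomial_function.intros)
qed (simp add: real_polynomial_function.intros)

text \<open>All contraction weights vanish at 0, so only the term with every edge deleted remains;
  \<open>c\<close> is the product of the deletion weights.\<close>

lemma Z_eval_0:
  "gadget_edges q N gs \<Longrightarrow>
    \<exists>c. c \<noteq> 0 \<and> (\<forall>n f. wZ q n f (eval_edges 0 gs) = c * q ^ card (f ` {..<n}))"
proof (induction gs)
  case (Cons g gs)
  obtain u w a b where g: "g = (u, w, a, b)" by (cases g) auto
  then have "a 0 \<noteq> 0" "b 0 = 0" "gadget_edges q N gs"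
    using Cons.prems by (auto simp: gadget_def)
  with Cons.IH obtain c where "c \<noteq> 0" "\<forall>n f. wZ q n f (eval_edges 0 gs) = c * q ^ card (f ` {..<n})"
    by auto
  then show ?case using \<open>a 0 \<noteq> 0\<close> \<open>b 0 = 0\<close> by (intro exI[of _ "a 0 * c"]) (simp add: g)
qed (auto intro: exI[of _ 1])

theorem gadget_subst:
  assumes gs: "gadget_edges q (k + 2) gs" and q: "q \<noteq> 0" "q \<noteq> 1"
  defines "T \<equiv> \<lambda>v. wZ q (k + 2) id (eval_edges v gs)"
    and "M \<equiv> \<lambda>v. wZ q (k + 2) (merge id 0 1) (eval_edges v gs)"
  shows "gadget q (\<lambda>v. (T v - M v) / (q * (q - 1))) (\<lambda>v. (q * M v - T v) / (q * (q - 1)))"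
  unfolding gadget_def
proof (intro conjI allI impI)
  have poly: "real_polynomial_function T" "real_polynomial_function M"
    using polynomial_Z[OF gs] by (simp_all add: T_def M_def)
  show "real_polynomial_function (\<lambda>v. (T v - M v) / (q * (q - 1)))"
    "real_polynomial_function (\<lambda>v. (q * M v - T v) / (q * (q - 1)))"
    unfolding divide_inverse
    by (intro real_polynomial_function.intros real_polynomial_function_diff poly)+
  obtain c where c: "c \<noteq> 0" "\<And>n f. wZ q n f (eval_edges 0 gs) = c * q ^ card (f ` {..<n})"
    using Z_eval_0[OF gs] by auto
  have "merge id 0 1 ` {..<k + 2} = {..<k + 2} - {1}"
  proof (intro equalityI subsetI)
    fix x assume "x \<in> {..<k + 2} - {1}"
    then show "x \<in> merge id 0 1 ` {..<k + 2}"
      by (intro image_eqI[of _ _ x]) (auto simp: merge_def)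
  qed (auto simp: merge_def)
  then have card: "card (merge id 0 1 ` {..<k + 2}) = k + 1" by simp
  \<comment> \<open>At 0 the two values differ by the factor \<open>q\<close>; hence the weight is 0
    there and the deletion coefficient is \<open>c * q ^ k\<close>.\<close>
  have T0: "T 0 = c * q ^ (k + 2)" using c by (simp add: T_def)
  have M0: "M 0 = c * q ^ (k + 1)" using c card by (simp add: M_def)
  have "T 0 - M 0 = c * q ^ (k + 1) * (q - 1)"
    unfolding T0 M0 by (simp add: algebra_simps)
  then show "(T 0 - M 0) / (q * (q - 1)) \<noteq> 0" using c q by simp
  show "(q * M 0 - T 0) / (q * (q - 1)) = 0" unfolding T0 M0 by simp
next
  fix v n i j assume ij: "i < n" "j < (n::nat)"
  let ?gs = "map (\<lambda>(u, w, a, b). (embed n i j u, embed n i j w, a, b)) gs"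
  have emb: "embed n i j x < n + k" if "x < k + 2" for x
    using that ij by (auto simp: embed_def)
  then have "gadget_edges q (n + k) ?gs" using gs by (fastforce simp: gadget_edges_def)
  then obtain m L where m: "n + k \<le> m" "pairs_below m L"
    "\<And>f es. labelling (n + k) f \<Longrightarrow> edges_below (n + k) es \<Longrightarrow>
      wZ q m f (plain_edges v L @ es) = wZ q (n + k) f (eval_edges v ?gs @ es)"
    using expand_gadgets by blast
  have ev: "eval_edges v ?gs = embed_edges n i j (eval_edges v gs)"
    by (auto simp: eval_edges_def embed_edges_def)
  have "wZ q m f (plain_edges v L @ es) =
     (T v - M v) / (q * (q - 1)) * wZ q n f es + (q * M v - T v) / (q * (q - 1)) * wZ q n (merge f i j) es"
    if "labelling n f" "edges_below n es" for f es
    using m(3)[of f es] labelling_mono[OF that(1), of "n + k"] edges_below_mono[OF that(2), of "n + k"]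
      two_terminal_expand[OF gadget_edges_below[OF gs] q ij that, of v]
    unfolding ev T_def M_def by simp
  then show "\<exists>m L. n \<le> m \<and> pairs_below m L \<and>
         (\<forall>f es. labelling n f \<longrightarrow> edges_below n es \<longrightarrow>
           wZ q m f (plain_edges v L @ es) = (T v - M v) / (q * (q - 1)) * wZ q n f es
             + (q * M v - T v) / (q * (q - 1)) * wZ q n (merge f i j) es)"
    using m(1,2) by (meson add_leD1)
qed

subsection \<open>Cliques and the Petersen graph\<close>

lemma Z_Nil_2: "wZ q 2 f [] = q ^ card {f 0, f 1}"
proof -
  have "{..<2} = {0, 1::nat}" by auto
  then show ?thesis by simp
qed

lemma Z_Nil_3: "wZ q 3 f [] = q ^ card {f 0, f 1, f 2}"
proof -
  have "{..<3} = {0, 1, 2::nat}" by auto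
  then show ?thesis by simp
qed

text \<open>For two parallel edges the new \<open>a + b\<close> is
  \<open>(a1 + b1) * (a2 + b2)\<close>, so \<open>1 + b / a\<close> is multiplicative.\<close>

lemma gadget_par:
  assumes "gadget q a1 b1" "gadget q a2 b2" "q \<noteq> 0" "q \<noteq> 1"
  shows "gadget q (\<lambda>v. a1 v * a2 v) (\<lambda>v. (a1 v + b1 v) * (a2 v + b2 v) - a1 v * a2 v)"
proof -
  let ?gs = "[(0, 1, a1, b1), (0, 1, a2, b2)]"
  let ?T = "\<lambda>v. wZ q 2 id (eval_edges v ?gs)"
  let ?M = "\<lambda>v. wZ q 2 (merge id 0 1) (eval_edges v ?gs)"
  have "gadget_edges q 2 ?gs" using assms by simp
  note g = gadget_subst[of q 0 ?gs, unfolded add_0, OF this assms(3,4)]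
  have m: "merge (merge id 0 1) 0 1 = merge id 0 1" by (rule merge_same) (simp add: merge_def)
  have T: "?T v = a1 v * a2 v * q\<^sup>2 + (a1 v * b2 v + b1 v * a2 v + b1 v * b2 v) * q" for v
    unfolding eval_edges_simps wZ.simps(2) Z_Nil_2 m
    by (simp add: merge_def card_insert_if algebra_simps power2_eq_square)
  have M: "?M v = (a1 v + b1 v) * (a2 v + b2 v) * q" for v
    unfolding eval_edges_simps wZ.simps(2) Z_Nil_2 m
    by (simp add: merge_def card_insert_if algebra_simps power2_eq_square)
  have "(\<lambda>v. (?T v - ?M v) / (q * (q - 1))) = (\<lambda>v. a1 v * a2 v)"
    unfolding T M using assms(3,4) by (auto simp: field_simps power2_eq_square)
  moreover have "(\<lambda>v. (q * ?M v - ?T v) / (q * (q - 1))) =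
      (\<lambda>v. (a1 v + b1 v) * (a2 v + b2 v) - a1 v * a2 v)"
    unfolding T M using assms(3,4) by (auto simp: field_simps power2_eq_square)
  ultimately show ?thesis using g by simp
qed

text \<open>For a path through the inner vertex 2 the new \<open>q * a + b\<close> is
  \<open>(q * a1 + b1) * (q * a2 + b2)\<close>, so \<open>1 + q * a / b\<close> is
  multiplicative.\<close>

lemma gadget_ser:
  assumes "gadget q a1 b1" "gadget q a2 b2" "q \<noteq> 0" "q \<noteq> 1"
  shows "gadget q (\<lambda>v. q * a1 v * a2 v + a1 v * b2 v + b1 v * a2 v) (\<lambda>v. b1 v * b2 v)"
proof -
  let ?gs = "[(0, 2, a1, b1), (2, 1, a2, b2)]"
  let ?T = "\<lambda>v. wZ q 3 id (eval_edges v ?gs)"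
  let ?M = "\<lambda>v. wZ q 3 (merge id 0 1) (eval_edges v ?gs)"
  have three: "1 + 2 = (3::nat)" by simp
  have "gadget_edges q 3 ?gs" using assms by simp
  note g = gadget_subst[of q 1 ?gs, unfolded three, OF this assms(3,4)]
  have T: "?T v = a1 v * a2 v * q ^ 3 + (a1 v * b2 v + b1 v * a2 v) * q\<^sup>2 + b1 v * b2 v * q" for v
    unfolding eval_edges_simps wZ.simps(2) Z_Nil_3
    by (simp add: merge_def card_insert_if algebra_simps power2_eq_square power3_eq_cube)
  have M: "?M v = a1 v * a2 v * q\<^sup>2 + (a1 v * b2 v + b1 v * a2 v) * q + b1 v * b2 v * q" for v
    unfolding eval_edges_simps wZ.simps(2) Z_Nil_3
    by (simp add: merge_def card_insert_if algebra_simps power2_eq_square)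
  have "(\<lambda>v. (?T v - ?M v) / (q * (q - 1))) = (\<lambda>v. q * a1 v * a2 v + a1 v * b2 v + b1 v * a2 v)"
    unfolding T M using assms(3,4) by (auto simp: field_simps power2_eq_square power3_eq_cube)
  moreover have "(\<lambda>v. (q * ?M v - ?T v) / (q * (q - 1))) = (\<lambda>v. b1 v * b2 v)"
    unfolding T M using assms(3,4) by (auto simp: field_simps power2_eq_square power3_eq_cube)
  ultimately show ?thesis using g by simp
qed

lemma Z_uniform:
  "a \<noteq> 0 \<Longrightarrow> wZ q n f (map (\<lambda>(u, w). (u, w, a, b)) L) = a ^ length L * wZ q n f (plain_edges (b / a) L)"
  by (induction L arbitrary: f) (auto simp: algebra_simps)

lemma continuous_Z_plain: "isCont (\<lambda>v. wZ q n f (plain_edges v L)) v"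
proof (induction L arbitrary: f)
  case (Cons e L)
  then show ?case by (cases e) (auto intro!: continuous_intros)
qed simp

text \<open>With one gadget on all edges everything is homogeneous of degree \<open>length L\<close>
  in \<open>a\<close> and \<open>b\<close>, so apart from a power of \<open>a\<close> only the
  weight \<open>b / a\<close> matters.\<close>

lemma gadget_uniform:
  assumes g: "gadget q a b" and L: "pairs_below (k + 2) L" and q: "q \<noteq> 0" "q \<noteq> 1"
  obtains A B where "gadget q A B"
    "\<And>v. a v \<noteq> 0 \<Longrightarrow> A v = a v ^ length L / (q * (q - 1)) *
       (wZ q (k + 2) id (plain_edges (b v / a v) L) - wZ q (k + 2) (merge id 0 1) (plain_edges (b v / a v) L))"
    "\<And>v. a v \<noteq> 0 \<Longrightarrow> B v = a v ^ length L / (q * (q - 1)) *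
       (q * wZ q (k + 2) (merge id 0 1) (plain_edges (b v / a v) L) - wZ q (k + 2) id (plain_edges (b v / a v) L))"
proof -
  let ?gs = "map (\<lambda>(u, w). (u, w, a, b)) L"
  have "gadget_edges q (k + 2) ?gs"
    using L g by (auto simp: pairs_below_def gadget_edges_def)
  note gd = gadget_subst[OF this q]
  have ev: "eval_edges v ?gs = map (\<lambda>(u, w). (u, w, a v, b v)) L" for v
    by (auto simp: eval_edges_def)
  show ?thesis
    by (rule that[OF gd]) (simp_all add: ev Z_uniform diff_divide_distrib algebra_simps)
qed

section \<open>Chromatic polynomials as values at weight -1\<close>

lemma Z_loop_zero:
  "(u, w, 1, -1) \<in> set es \<Longrightarrow> f u = f w \<Longrightarrow> wZ q n f es = 0"
proof (induction es arbitrary: f)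
  case (Cons e es)
  obtain u' w' a b where e: "e = (u', w', a, b)" by (cases e) auto
  show ?case
  proof (cases "e = (u, w, 1, -1)")
    case True
    \<comment> \<open>The deletion and contraction terms of a loop of weight -1 cancel; a graph with
      a loop has no proper colouring.\<close>
    then show ?thesis using Cons.prems by (simp add: merge_same)
  next
    case False
    then have "(u, w, 1, -1) \<in> set es" using Cons.prems by auto
    moreover have "merge f u' w' u = merge f u' w' w" using Cons.prems by (simp add: merge_def)
    ultimately show ?thesis using Cons.IH[of f] Cons.IH[of "merge f u' w'"] Cons.prems e by simp
  qed
qed simp

lemma Z_isolated:
  "labelling n f \<Longrightarrow> edges_below n es \<Longrightarrow> wZ q (Suc n) f es = q * wZ q n f es"
proof (induction es arbitrary: f)
  case Nil
  then have "f ` {..<Suc n} = insert n (f ` {..<n})" "n \<notin> f ` {..<n}"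
    by (auto simp: lessThan_Suc labelling_def)
  then show ?case by simp
next
  case (Cons e es)
  then show ?case by (cases e) (auto simp: labelling_merge algebra_simps)
qed

lemma Z_pendant:
  "labelling n f \<Longrightarrow> s < n \<Longrightarrow> edges_below n es \<Longrightarrow> wZ q (Suc n) (merge f n s) es = wZ q n f es"
proof (induction es arbitrary: f)
  case Nil
  then have n: "f n = n" "f s < n" and *: "\<And>x. x < n \<Longrightarrow> f x < n"
    by (auto simp: labelling_def)
  have "merge f n s x = f x" if "x < n" for x
    using n *[OF that] by (auto simp: merge_def)
  then have "merge f n s ` {..<n} = f ` {..<n}" by auto
  moreover have "merge f n s n = f s" using n by (simp add: merge_def)
  ultimately have "merge f n s ` {..<Suc n} = f ` {..<n}"
    using Nil(2) by (auto simp: lessThan_Suc)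
  then show ?case by simp
next
  case (Cons e es)
  then show ?case by (cases e) (auto simp: labelling_merge merge_commute[of f n s])
qed

definition star :: "nat \<Rightarrow> nat list \<Rightarrow> (nat \<times> nat) list" where
  "star n ss = map (\<lambda>s. (n, s)) ss"

text \<open>At weight -1 this is a statement on colourings: the labels form a clique, so the
  neighbours of the new vertex \<open>n\<close> use up one colour per label, and the remaining
  colours are free for \<open>n\<close>.\<close>

lemma Z_star:
  assumes f: "labelling n f" and C: "pairs_below n C"
    and clique: "\<And>a b. a < n \<Longrightarrow> b < n \<Longrightarrow> f a \<noteq> f b \<Longrightarrow> (a, b) \<in> set C \<or> (b, a) \<in> set C"
    and ss: "set ss \<subseteq> {..<n}"
  shows "wZ q (Suc n) f (plain_edges (-1) (star n ss @ C)) =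
    (q - card (f ` set ss)) * wZ q n f (plain_edges (-1) C)"
  using ss
proof (induction ss)
  case Nil
  then show ?case using Z_isolated[OF f pairs_below_edges[OF C]] by (simp add: star_def)
next
  case (Cons s ss)
  let ?g = "merge f n s" and ?C = "plain_edges (-1) C"
  have fl: "f n = n" "\<And>x. x < n \<Longrightarrow> f x < n" using f by (auto simp: labelling_def)
  have s: "s < n" using Cons by auto
  have gx: "?g x = f x" if "x < n" for x
    using fl(1) fl(2)[OF that] fl(2)[OF s] by (auto simp: merge_def)
  have gn: "?g n = f s" using fl(1) fl(2)[OF s] by (simp add: merge_def)
  have 1: "wZ q (Suc n) f (plain_edges (-1) (star n (s # ss) @ C)) =
    (q - card (f ` set ss)) * wZ q n f ?C - wZ q (Suc n) ?g (plain_edges (-1) (star n ss @ C))"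
    using Cons by (simp add: star_def)
  show ?case
  proof (cases "f s \<in> f ` set ss")
    case True
    then obtain s' where s': "s' \<in> set ss" "f s' = f s" by auto
    then have "(n, s', 1, -1) \<in> set (plain_edges (-1) (star n ss @ C))"
      by (auto simp: star_def plain_edges_def)
    moreover have "?g n = ?g s'" using s' gn gx Cons by auto
    ultimately have "wZ q (Suc n) ?g (plain_edges (-1) (star n ss @ C)) = 0"
      by (rule Z_loop_zero)
    moreover have "f ` set (s # ss) = f ` set ss" using True by auto
    ultimately show ?thesis using 1 by simp
  next
    case False
    \<comment> \<open>Once \<open>n\<close> is identified with \<open>s\<close>, contracting an edge
      from \<open>n\<close> to \<open>t\<close> would turn the clique edge between \<open>s\<close>
      and \<open>t\<close> into a loop. Such edges thus act as if deleted.\<close>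
    have "wZ q (Suc n) ?g (plain_edges (-1) (star n ts @ C)) = wZ q (Suc n) ?g ?C"
      if "set ts \<subseteq> set ss" for ts
      using that
    proof (induction ts)
      case (Cons t ts)
      have "t \<in> set ss" using Cons.prems by simp
      then have "f t \<in> f ` set ss" by (rule imageI)
      then have t: "f t \<noteq> f s" "t < n"
        using False \<open>t \<in> set ss\<close> \<open>set (s # ss) \<subseteq> {..<n}\<close> by (metis, auto)
      then obtain a b where ab: "(a, b) \<in> set C" "(a = s \<and> b = t) \<or> (a = t \<and> b = s)"
        using clique[OF t(2) s t(1)] by blast
      have "merge ?g n t a = merge ?g n t b"
        using ab(2) gn gx[OF s] gx[OF t(2)] by (auto simp: merge_def)
      moreover have "(a, b, 1, -1) \<in> set (plain_edges (-1) (star n ts @ C))"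
        using ab(1) by (auto simp: plain_edges_def)
      ultimately have "wZ q (Suc n) (merge ?g n t) (plain_edges (-1) (star n ts @ C)) = 0"
        by (intro Z_loop_zero)
      then show ?case using Cons by (simp add: star_def)
    qed (simp add: star_def)
    then have "wZ q (Suc n) ?g (plain_edges (-1) (star n ss @ C)) = wZ q n f ?C"
      using Z_pendant[OF f s pairs_below_edges[OF C]] by simp
    moreover have "card (f ` set (s # ss)) = Suc (card (f ` set ss))" using False by simp
    ultimately show ?thesis using 1 by (simp add: algebra_simps)
  qed
qed

text \<open>The complete graph on \<open>k + 2\<close> vertices without the edge between the terminals 0 and 1.\<close>

fun near_clique :: "nat \<Rightarrow> (nat \<times> nat) list" where
  "near_clique 0 = []"
| "near_clique (Suc k) = star (k + 2) [0..<k + 2] @ near_clique k"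

lemma near_clique_set: "(x, y) \<in> set (near_clique k) \<longleftrightarrow> 2 \<le> x \<and> x < k + 2 \<and> y < x"
  by (induction k) (auto simp: star_def)

lemma near_clique_below: "pairs_below (k + 2) (near_clique k)"
  by (auto simp: pairs_below_def near_clique_set)

text \<open>Identifying the terminals leaves, up to parallel edges, the complete graph on
  \<open>k + 1\<close> vertices.\<close>

lemma Z_near_clique_merged:
  "wZ q (k + 2) (merge id 0 1) (plain_edges (-1) (near_clique k)) = (\<Prod>i<k + 1. q - real i)"
proof (induction k)
  case 0
  show ?case by (simp add: Z_Nil_2 merge_def del: wZ.simps(1) add_2_eq_Suc add_2_eq_Suc')
next
  case (Suc k)
  let ?f = "merge id 0 1"
  have f: "?f x = (if x = 1 then 0 else x)" for x by (auto simp: merge_def)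
  have lab: "labelling (k + 2) ?f" by (rule labelling_merge[OF labelling_id]) auto
  have "?f ` set [0..<k + 2] = {..<k + 2} - {1}"
  proof (intro equalityI subsetI)
    fix x assume "x \<in> {..<k + 2} - {1}"
    then show "x \<in> ?f ` set [0..<k + 2]" by (intro image_eqI[of _ _ x]) (auto simp: merge_def)
  qed (auto simp: merge_def split: if_splits)
  then have card: "card (?f ` set [0..<k + 2]) = k + 1" by simp
  have cl: "(a, b) \<in> set (near_clique k) \<or> (b, a) \<in> set (near_clique k)"
    if "a < k + 2" "b < k + 2" "?f a \<noteq> ?f b" for a b
    using that unfolding near_clique_set f by (auto split: if_splits)
  have "wZ q (Suc (k + 2)) ?f (plain_edges (-1) (near_clique (Suc k))) =
      (q - real (k + 1)) * (\<Prod>i<k + 1. q - real i)"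
    unfolding Suc[symmetric] near_clique.simps
    by (rule Z_star[OF lab near_clique_below cl, of "[0..<k + 2]", unfolded card]) auto
  moreover have "Suc k + 2 = Suc (k + 2)" "Suc k + 1 = Suc (k + 1)" by simp_all
  ultimately show ?case by (simp only: prod.lessThan_Suc mult.commute)
qed

text \<open>The difference is deletion-contraction for the missing edge at weight -1, hence belongs
  to the complete graph on \<open>k + 2\<close> vertices.\<close>

lemma Z_near_clique_diff:
  "wZ q (k + 2) id (plain_edges (-1) (near_clique k))
     - wZ q (k + 2) (merge id 0 1) (plain_edges (-1) (near_clique k)) = (\<Prod>i<k + 2. q - real i)"
proof -
  \<comment> \<open>The terminal edge stands last, so that the induction can strip the stars from
    the front.\<close>
  have "wZ q (k + 2) id (plain_edges (-1) (near_clique k @ [(0, 1)])) = (\<Prod>i<k + 2. q - real i)"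
  proof (induction k)
    case 0
    have "(\<Prod>i<2. q - real i) = q * (q - 1)" by (simp add: numeral_2_eq_2)
    then show ?case
      by (simp add: Z_Nil_2 merge_def card_insert_if power2_eq_square algebra_simps
          del: wZ.simps(1) add_2_eq_Suc add_2_eq_Suc')
  next
    case (Suc k)
    let ?C = "near_clique k @ [(0, 1)]"
    have C: "pairs_below (k + 2) ?C"
      using near_clique_below[of k] by (simp add: pairs_below_def)
    have cl: "(a, b) \<in> set ?C \<or> (b, a) \<in> set ?C"
      if "a < k + 2" "b < k + 2" "id a \<noteq> id b" for a b
      using that by (auto simp: near_clique_set)
    have "wZ q (Suc (k + 2)) id (plain_edges (-1) (near_clique (Suc k) @ [(0, 1)])) =
        (q - real (k + 2)) * (\<Prod>i<k + 2. q - real i)"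
      unfolding Suc[symmetric] near_clique.simps append_assoc
      by (subst Z_star[OF labelling_id C cl]) auto
    moreover have "Suc k + 2 = Suc (k + 2)" by simp
    ultimately show ?case by (simp only: prod.lessThan_Suc mult.commute)
  qed
  moreover have "wZ q (k + 2) id (plain_edges (-1) (near_clique k @ [(0, 1)])) =
      wZ q (k + 2) id (plain_edges (-1) ((0, 1) # near_clique k))"
    using Z_append_commute[of q "k + 2" id "plain_edges (-1) (near_clique k)" "plain_edges (-1) [(0, 1)]"]
    by simp
  ultimately show ?thesis by simp
qed

section \<open>Flow polynomials by evaluation\<close>

definition merge_list :: "nat list \<Rightarrow> nat \<Rightarrow> nat \<Rightarrow> nat list" where
  "merge_list ls u w =
     (let p = ls ! u; r = ls ! w; m = min p r in map (\<lambda>l. if l = p \<or> l = r then m else l) ls)"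

fun padd :: "int list \<Rightarrow> int list \<Rightarrow> int list" where
  "padd [] ys = ys"
| "padd xs [] = xs"
| "padd (x # xs) (y # ys) = (x + y) # padd xs ys"

text \<open>Coefficients of \<open>wZ\<close> at weight \<open>- q\<close> in ascending order, with
  the labelling stored as a list to be executable; prefixing 0 and negating multiplies by
  \<open>- q\<close>. Up to sign and a power of \<open>q\<close> this is the flow
  polynomial.\<close>

fun flow_poly :: "nat list \<Rightarrow> (nat \<times> nat) list \<Rightarrow> int list" where
  "flow_poly ls [] = replicate (length (remdups ls)) 0 @ [1]"
| "flow_poly ls ((u, w) # es) =
    (if ls ! u = ls ! w then let p = flow_poly ls es in padd p (0 # map uminus p)
     else padd (flow_poly ls es) (0 # map uminus (flow_poly (merge_list ls u w) es)))"

abbreviation peval :: "real \<Rightarrow> int list \<Rightarrow> real" where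
  "peval \<equiv> horner_sum of_int"

lemma peval_padd: "peval q (padd xs ys) = peval q xs + peval q ys"
  by (induction xs ys rule: padd.induct) (auto simp: algebra_simps)

lemma peval_uminus: "peval q (map uminus xs) = - peval q xs"
  by (induction xs) auto

lemma peval_monom: "peval q (replicate n 0 @ [1]) = q ^ n"
  by (induction n) auto

lemma Z_flow_poly:
  "pairs_below n es \<Longrightarrow> wZ q n f (plain_edges (- q) es) = peval q (flow_poly (map f [0..<n]) es)"
proof (induction es arbitrary: f)
  case Nil
  have "card (f ` {..<n}) = length (remdups (map f [0..<n]))"
    using length_remdups_card_conv[of "map f [0..<n]"] by (simp add: atLeast_upt)
  then show ?case by (simp add: peval_monom del: map_map)
next
  case (Cons e es)
  obtain u w where e: "e = (u, w)" by (cases e)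
  have uw: "u < n" "w < n" "pairs_below n es" using Cons.prems by (auto simp: e pairs_below_def)
  have "merge_list (map f [0..<n]) u w = map (merge f u w) [0..<n]"
    using uw by (auto simp: merge_list_def merge_def Let_def)
  then show ?case
    using Cons.IH[OF uw(3), of f] Cons.IH[OF uw(3), of "merge f u w"] uw(1,2)
    by (simp add: e peval_padd peval_uminus Let_def merge_same)
qed

text \<open>The Petersen graph without the edge between its vertices 0 and 1.\<close>

definition petersen_minus :: "(nat \<times> nat) list" where
  "petersen_minus = [(1, 4), (1, 5), (5, 9), (5, 7), (3, 9), (6, 9), (0, 3), (0, 2), (2, 7),
     (2, 6), (4, 6), (3, 8), (7, 8), (4, 8)]"

lemma flow_poly_petersen:
  "flow_poly [0, 1, 2, 3, 4, 5, 6, 7, 8, 9] petersen_minus =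
     [0, 0, 0, 0, 0, 0, 0, 0, 0, 0, - 66, 157, - 138, 58, - 12, 1]"
  unfolding petersen_minus_def by code_simp

lemma flow_poly_petersen_merged:
  "flow_poly [0, 0, 2, 3, 4, 5, 6, 7, 8, 9] petersen_minus =
     [0, 0, 0, 0, 0, 0, 0, 0, 0, 174, - 463, 486, - 267, 83, - 14, 1]"
  unfolding petersen_minus_def by code_simp

lemma petersen_below: "pairs_below (8 + 2) petersen_minus"
  by (simp add: pairs_below_def petersen_minus_def)

lemma Z_petersen:
  "wZ q (8 + 2) id (plain_edges (- q) petersen_minus) =
     q ^ 10 * ((q - 1) * (q - 2) * (q - 3) * ((q - 3)\<^sup>2 + 2))"
proof -
  have "map id [0..<8 + 2] = [0, 1, 2, 3, 4, 5, 6, 7, 8, 9::nat]"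
    by (simp add: upt_rec)
  note eq = this
  show ?thesis
    unfolding Z_flow_poly[OF petersen_below] eq
      flow_poly_petersen horner_sum_simps of_int_0 of_int_1 of_int_numeral of_int_minus by algebra
qed

text \<open>Restoring the terminal edge with weight \<open>- q\<close> gives the negative of the
  left-hand side, which is therefore \<open>q ^ 10\<close> times the flow polynomial of the Petersen
  graph.\<close>

lemma Z_petersen_merged:
  "q * wZ q (8 + 2) (merge id 0 1) (plain_edges (- q) petersen_minus)
     - wZ q (8 + 2) id (plain_edges (- q) petersen_minus) =
   q ^ 10 * ((q - 1) * (q - 2) * (q - 3) * (q - 4) * (q\<^sup>2 - 5 * q + 10))"
proof -
  have "map (merge id 0 1) [0..<8 + 2] = [0, 0, 2, 3, 4, 5, 6, 7, 8, 9::nat]"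
    by (simp add: upt_rec merge_def)
  note eq = this
  show ?thesis
    unfolding Z_petersen unfolding Z_flow_poly[OF petersen_below] eq
      flow_poly_petersen_merged horner_sum_simps of_int_0 of_int_1 of_int_numeral of_int_minus by algebra
qed

subsection \<open>Zeros from effective weights\<close>

lemma abs_ln_one_plus_bounds:
  fixes z :: real
  assumes "\<bar>z\<bar> \<le> 1 / 4"
  shows "\<bar>z\<bar> / 2 \<le> \<bar>ln (1 + z)\<bar>" "\<bar>ln (1 + z)\<bar> \<le> 2 * \<bar>z\<bar>"
proof -
  have 1: "\<bar>ln (1 + z) - z\<bar> \<le> 2 * z\<^sup>2"
    using assms by (intro abs_ln_one_plus_x_minus_x_bound) auto
  have "z\<^sup>2 \<le> \<bar>z\<bar> * (1 / 4)"
  proof -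
    have "z\<^sup>2 = \<bar>z\<bar> * \<bar>z\<bar>" by (simp add: power2_eq_square)
    then show ?thesis using mult_left_mono[OF assms abs_ge_zero[of z]] by simp
  qed
  with 1 have "\<bar>ln (1 + z) - z\<bar> \<le> \<bar>z\<bar> / 2" by linarith
  then show "\<bar>z\<bar> / 2 \<le> \<bar>ln (1 + z)\<bar>" "\<bar>ln (1 + z)\<bar> \<le> 2 * \<bar>z\<bar>" by linarith+
qed

lemma lim_power_inverse:
  fixes Y :: real
  assumes "1 < \<bar>Y\<bar>"
  shows "(\<lambda>n. (1 / Y) ^ n) \<longlonglongrightarrow> 0" "(\<lambda>n. c / (Y ^ n - 1)) \<longlonglongrightarrow> 0"
proof -
  show lim: "(\<lambda>n. (1 / Y) ^ n) \<longlonglongrightarrow> 0"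
    using assms by (intro LIMSEQ_power_zero) (simp add: field_simps)
  have "(\<lambda>n. c * (1 / Y) ^ n / (1 - (1 / Y) ^ n)) \<longlonglongrightarrow> c * 0 / (1 - 0)"
    by (rule tendsto_divide[OF tendsto_mult[OF tendsto_const lim] tendsto_diff[OF tendsto_const lim]]) simp
  moreover have "c * (1 / Y) ^ n / (1 - (1 / Y) ^ n) = c / (Y ^ n - 1)" for n
    using assms by (simp add: field_simps power_divide)
  ultimately show "(\<lambda>n. c / (Y ^ n - 1)) \<longlonglongrightarrow> 0" by simp
qed

lemma power_sign:
  fixes y :: real
  assumes "y < -1" "n \<ge> 1"
  shows "even n \<Longrightarrow> y ^ n > 1" "odd n \<Longrightarrow> y ^ n < -1"
proof -
  have "1 < \<bar>y\<bar> ^ n" using assms by (intro one_less_power) auto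
  moreover have "\<bar>y\<bar> ^ n = (if even n then y ^ n else - (y ^ n))"
    using assms by (auto simp: abs_if power_minus_odd)
  ultimately show "even n \<Longrightarrow> y ^ n > 1" "odd n \<Longrightarrow> y ^ n < -1" by (auto split: if_splits)
qed

text \<open>The factors \<open>1 + q / (Y ^ n - 1)\<close> tend to 1, at rates that differ at two points where \<open>Y\<close>
  differs; so a suitable power of one of them passes the value of \<open>s\<close> between the two points. The
  parity of \<open>n\<close> decides from which side the factors approach 1.\<close>

lemma crossing:
  fixes Y s :: "real \<Rightarrow> real" and q :: real
  assumes Y: "continuous_on {l..u} Y" and s: "continuous_on {l..u} s"
    and Ylt: "\<And>v. v \<in> {l..u} \<Longrightarrow> Y v < -1"
    and spos: "\<And>v. v \<in> {l..u} \<Longrightarrow> 0 < s v \<and> s v \<noteq> 1"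
    and q: "q \<noteq> 0"
    and pr: "p \<in> {l..u}" "r \<in> {l..u}" "Y r < Y p"
  obtains v n k where "v \<in> {l..u}" "n \<ge> 1" "k \<ge> 1"
    "\<And>w. w \<in> {l..u} \<Longrightarrow> 0 < 1 + q / (Y w ^ n - 1) \<and> 1 + q / (Y w ^ n - 1) \<noteq> 1"
    "(1 + q / (Y v ^ n - 1)) ^ k = s v"
proof -
  define z where "z n v = q / (Y v ^ n - 1)" for n v
  define L where "L n v = \<bar>ln (1 + z n v)\<bar>" for n v
  have ln_s: "ln (s v) \<noteq> 0" if "v \<in> {l..u}" for v using spos[OF that] by simp
  have ne: "{l..u} \<noteq> {}" using pr by auto
  \<comment> \<open>The absolute value of \<open>Y\<close> is least at \<open>m\<close>, which
    bounds \<open>z n\<close> uniformly over the interval.\<close>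
  obtain m where m: "m \<in> {l..u}" "\<And>v. v \<in> {l..u} \<Longrightarrow> Y v \<le> Y m"
    using continuous_attains_sup[OF compact_Icc ne Y] by blast
  have lim_z: "(\<lambda>n. z n v) \<longlonglongrightarrow> 0" if "v \<in> {l..u}" for v
    unfolding z_def using Ylt[OF that] by (intro lim_power_inverse) simp
  have z_le: "\<bar>z n v\<bar> \<le> \<bar>q\<bar> / (\<bar>Y m\<bar> ^ n - 1)" if v: "v \<in> {l..u}" and n: "n \<ge> 1" for n v
  proof -
    have "\<bar>Y m\<bar> ^ n \<le> \<bar>Y v\<bar> ^ n" using m(2)[OF v] Ylt[OF m(1)] by (intro power_mono) auto
    moreover have "\<bar>Y v\<bar> ^ n = \<bar>Y v ^ n\<bar>" by (simp add: power_abs)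
    ultimately have "\<bar>Y m\<bar> ^ n - 1 \<le> \<bar>Y v ^ n - 1\<bar>" by linarith
    moreover have "1 < \<bar>Y m\<bar> ^ n" using Ylt[OF m(1)] n by (intro one_less_power) auto
    ultimately show ?thesis unfolding z_def abs_divide by (intro divide_left_mono) auto
  qed
  have "(\<lambda>n. \<bar>q\<bar> / (\<bar>Y m\<bar> ^ n - 1)) \<longlonglongrightarrow> 0"
    using Ylt[OF m(1)] by (intro lim_power_inverse) simp
  then have ev1: "\<forall>\<^sub>F n in sequentially. \<bar>q\<bar> / (\<bar>Y m\<bar> ^ n - 1) < 1 / 4"
    by (rule order_tendstoD) simp
  \<comment> \<open>This leaves room at \<open>r\<close> for the one extra factor that rounding
    \<open>k\<close> up may cost.\<close>
  have ev2: "\<forall>\<^sub>F n in sequentially. 2 * \<bar>z n r\<bar> < \<bar>ln (s r)\<bar> / 2"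
  proof -
    have "(\<lambda>n. 2 * \<bar>z n r\<bar>) \<longlonglongrightarrow> 2 * \<bar>0\<bar>" by (intro tendsto_intros lim_z pr)
    then show ?thesis by (rule order_tendstoD(2)) (use ln_s[OF pr(2)] in simp)
  qed
  \<comment> \<open>\<open>Y r\<close> exceeds \<open>Y p\<close> in absolute value, so the factors
    tend to 1 faster at \<open>r\<close>. The 4 combines the two factors 2 in the bounds for the
    logarithm.\<close>
  have ev3: "\<forall>\<^sub>F n in sequentially.
      \<bar>ln (s p)\<bar> * (4 * \<bar>(Y p ^ n - 1) / (Y r ^ n - 1)\<bar>) < \<bar>ln (s r)\<bar> / 2"
  proof -
    have "\<bar>Y p / Y r\<bar> < 1"
      using Ylt[OF pr(1)] Ylt[OF pr(2)] pr(3) by (simp add: abs_divide divide_less_eq)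
    then have 1: "(\<lambda>n. (Y p / Y r) ^ n) \<longlonglongrightarrow> 0" by (intro LIMSEQ_power_zero) simp
    have 2: "(\<lambda>n. (1 / Y r) ^ n) \<longlonglongrightarrow> 0"
      using Ylt[OF pr(2)] by (intro lim_power_inverse) simp
    have "(\<lambda>n. ((Y p / Y r) ^ n - (1 / Y r) ^ n) / (1 - (1 / Y r) ^ n)) \<longlonglongrightarrow> (0 - 0) / (1 - 0)"
      by (rule tendsto_divide[OF tendsto_diff[OF 1 2] tendsto_diff[OF tendsto_const 2]]) simp
    moreover have "((Y p / Y r) ^ n - (1 / Y r) ^ n) / (1 - (1 / Y r) ^ n) = (Y p ^ n - 1) / (Y r ^ n - 1)" for n
    proof -
      have "(Y p / Y r) ^ n - (1 / Y r) ^ n = (Y p ^ n - 1) / Y r ^ n"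
        "1 - (1 / Y r) ^ n = (Y r ^ n - 1) / Y r ^ n"
        using Ylt[OF pr(2)] by (auto simp: power_divide diff_divide_distrib)
      then show ?thesis using Ylt[OF pr(2)] by simp
    qed
    ultimately have "(\<lambda>n. (Y p ^ n - 1) / (Y r ^ n - 1)) \<longlonglongrightarrow> 0" by simp
    then have "(\<lambda>n. \<bar>ln (s p)\<bar> * (4 * \<bar>(Y p ^ n - 1) / (Y r ^ n - 1)\<bar>)) \<longlonglongrightarrow> \<bar>ln (s p)\<bar> * (4 * \<bar>0\<bar>)"
      by (intro tendsto_intros)
    then show ?thesis by (rule order_tendstoD(2)) (use ln_s[OF pr(2)] in simp)
  qed
  obtain N where N: "\<And>n. n \<ge> N \<Longrightarrow> \<bar>q\<bar> / (\<bar>Y m\<bar> ^ n - 1) < 1 / 4 \<and> 2 * \<bar>z n r\<bar> < \<bar>ln (s r)\<bar> / 2 \<and>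
      \<bar>ln (s p)\<bar> * (4 * \<bar>(Y p ^ n - 1) / (Y r ^ n - 1)\<bar>) < \<bar>ln (s r)\<bar> / 2"
    using eventually_conj[OF ev1 eventually_conj[OF ev2 ev3]] unfolding eventually_sequentially by blast
  define up where "up \<longleftrightarrow> s p > 1"
  \<comment> \<open>By connectedness \<open>s\<close> stays on one side of 1.\<close>
  have up: "s v > 1 \<longleftrightarrow> up" if v: "v \<in> {l..u}" for v
  proof (rule ccontr)
    assume *: "(s v > 1) \<noteq> up"
    have "connected (s ` {l..u})" using s by (intro connected_continuous_image) auto
    moreover have "s v \<in> s ` {l..u}" "s p \<in> s ` {l..u}" using v pr by auto
    ultimately have "1 \<in> s ` {l..u}"
      using * unfolding connected_iff_interval up_def by (metis linear not_le less_imp_le)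
    then show False using spos by auto
  qed
  \<comment> \<open>For even \<open>n\<close> the sign of \<open>z n\<close> is that of
    \<open>q\<close>, for odd \<open>n\<close> the opposite one. The parity puts the factors on the
    same side of 1 as \<open>s\<close>.\<close>
  define n where "n = 2 * N + (if up = (0 < q) then 2 else 1)"
  have n1: "n \<ge> 1" "n \<ge> N" by (auto simp: n_def)
  have en: "even n \<longleftrightarrow> (up = (0 < q))" by (auto simp: n_def)
  have zs: "z n v \<noteq> 0 \<and> (z n v > 0 \<longleftrightarrow> up) \<and> \<bar>z n v\<bar> \<le> 1 / 4" if v: "v \<in> {l..u}" for v
  proof -
    have "\<bar>z n v\<bar> \<le> 1 / 4" using z_le[OF v n1(1)] N[OF n1(2)] by linarith
    moreover have "z n v \<noteq> 0 \<and> (z n v > 0 \<longleftrightarrow> up)"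
      using power_sign[OF Ylt[OF v] n1(1)] en q
      by (cases "even n") (auto simp: z_def zero_less_divide_iff)
    ultimately show ?thesis by simp
  qed
  have zpos: "0 < 1 + z n v" if "v \<in> {l..u}" for v using zs[OF that] by linarith
  have lnz: "ln (1 + z n v) = (if up then L n v else - L n v)" if v: "v \<in> {l..u}" for v
    using zs[OF v] zpos[OF v] ln_gt_zero_iff[of "1 + z n v"] ln_less_zero_iff[of "1 + z n v"]
    by (auto simp: L_def abs_if)
  have lns: "ln (s v) = (if up then \<bar>ln (s v)\<bar> else - \<bar>ln (s v)\<bar>)" if v: "v \<in> {l..u}" for v
    using up[OF v] spos[OF v] by (auto simp: abs_if)
  have Lp: "\<bar>z n p\<bar> / 2 \<le> L n p" "0 < L n p"
    using abs_ln_one_plus_bounds(1)[of "z n p"] zs[OF pr(1)] by (auto simp: L_def)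
  have Lr: "L n r \<le> 2 * \<bar>z n r\<bar>"
    using abs_ln_one_plus_bounds(2)[of "z n r"] zs[OF pr(2)] by (auto simp: L_def)
  \<comment> \<open>The least number of factors that passes \<open>s\<close> at \<open>p\<close>; at
    \<open>r\<close> the same number still falls short.\<close>
  define k where "k = nat \<lfloor>\<bar>ln (s p)\<bar> / L n p\<rfloor> + 1"
  have k: "\<bar>ln (s p)\<bar> / L n p < real k" "real k \<le> \<bar>ln (s p)\<bar> / L n p + 1"
    using Lp unfolding k_def by (auto simp: of_nat_nat) linarith+
  have kp: "\<bar>ln (s p)\<bar> < real k * L n p" using k(1) Lp(2) by (simp add: field_simps)
  have "real k * L n r < \<bar>ln (s r)\<bar>"
  proof -
    have "real k * L n r \<le> (\<bar>ln (s p)\<bar> / L n p + 1) * L n r"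
      using k(2) by (intro mult_right_mono) (auto simp: L_def)
    also have "\<dots> = \<bar>ln (s p)\<bar> * (L n r / L n p) + L n r" by (simp add: algebra_simps)
    also have "L n r / L n p \<le> (2 * \<bar>z n r\<bar>) / (\<bar>z n p\<bar> / 2)"
      using Lp Lr zs[OF pr(1)] by (intro frac_le) auto
    also have "(2 * \<bar>z n r\<bar>) / (\<bar>z n p\<bar> / 2) = 4 * \<bar>(Y p ^ n - 1) / (Y r ^ n - 1)\<bar>"
      using q by (simp add: z_def abs_divide field_simps)
    finally have "real k * L n r \<le> \<bar>ln (s p)\<bar> * (4 * \<bar>(Y p ^ n - 1) / (Y r ^ n - 1)\<bar>) + L n r"
      by (simp add: mult_left_mono)
    then show ?thesis using N[OF n1(2)] Lr by linarith
  qed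
  note kr = this
  define h where "h v = real k * ln (1 + z n v) - ln (s v)" for v
  have den: "Y v ^ n - 1 \<noteq> 0" if "v \<in> {l..u}" for v
    using power_sign[OF Ylt[OF that] n1(1)] by (cases "even n") auto
  have "continuous_on {l..u} h"
    unfolding h_def z_def
    by (intro continuous_intros Y s) (use den zpos spos in \<open>force simp: z_def\<close>)+
  then have "connected (h ` {l..u})" by (intro connected_continuous_image) auto
  moreover have "h p \<in> h ` {l..u}" "h r \<in> h ` {l..u}" using pr by auto
  moreover have "h p > 0 \<and> h r < 0 \<or> h p < 0 \<and> h r > 0"
    unfolding h_def lnz[OF pr(1)] lnz[OF pr(2)] using kp kr lns[OF pr(1)] lns[OF pr(2)]
    by (cases up) auto
  ultimately have "0 \<in> h ` {l..u}"
    unfolding connected_iff_interval by (meson less_imp_le)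
  then obtain v where v: "v \<in> {l..u}" "real k * ln (1 + z n v) = ln (s v)"
    by (auto simp: h_def)
  have "ln ((1 + z n v) ^ k) = ln (s v)" using v zpos[OF v(1)] by (simp add: ln_realpow)
  then have "(1 + z n v) ^ k = s v" using zpos[OF v(1)] spos[OF v(1)] by simp
  then show ?thesis
    using that[of v n k] v(1) n1(1) zs zpos unfolding z_def k_def by auto
qed

lemma continuous_on_subinterval:
  fixes g :: "real \<Rightarrow> real"
  assumes "continuous_on {l..u} g" "l < u" "v \<in> {l..u}" "g v < c"
  obtains l' u' where "l \<le> l'" "l' < u'" "u' \<le> u" "\<And>w. w \<in> {l'..u'} \<Longrightarrow> g w < c"
proof -
  obtain d where d: "d > 0" "\<And>w. w \<in> {l..u} \<Longrightarrow> dist w v < d \<Longrightarrow> dist (g w) (g v) < c - g v"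
    using assms unfolding continuous_on_iff by (metis diff_gt_0_iff_gt)
  have *: "g w < c" if "w \<in> {l..u}" "\<bar>w - v\<bar> < d" for w
    using d(2)[OF that(1)] that(2) by (auto simp: dist_real_def)
  show ?thesis
  \<comment> \<open>As \<open>v\<close> may be an endpoint, the subinterval is taken on one side of
    it.\<close>
  proof (cases "v < u")
    case True
    show ?thesis
      by (rule that[of v "min u (v + d / 2)"]) (use True assms d(1) in \<open>auto intro!: *\<close>)
  next
    case False
    show ?thesis
      by (rule that[of "max l (v - d / 2)" v]) (use False assms d(1) in \<open>auto intro!: *\<close>)
  qed
qed

section \<open>Abstract calculus of effective weights\<close>

text \<open>\<open>R l u x y\<close> says that on the interval from \<open>l\<close> to \<open>u\<close> the functions \<open>x = 1 + q / w\<close> and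
  \<open>y = 1 + w\<close> come from the effective weight \<open>w\<close> of a two-terminal graph. Parallel composition
  multiplies \<open>y\<close> and series composition multiplies \<open>x\<close>, so that the axioms are invariant under
  exchanging \<open>x\<close> and \<open>y\<close>.\<close>

locale weights =
  fixes q :: real and R :: "real \<Rightarrow> real \<Rightarrow> (real \<Rightarrow> real) \<Rightarrow> (real \<Rightarrow> real) \<Rightarrow> bool"
    and root :: "real \<Rightarrow> bool"
  assumes q0: "q \<noteq> 0"
    and rel: "R l u x y \<Longrightarrow> v \<in> {l..u} \<Longrightarrow> (x v - 1) * (y v - 1) = q"
    and sub: "R l u x y \<Longrightarrow> l \<le> l' \<Longrightarrow> u' \<le> u \<Longrightarrow> R l' u' x y"
    and cong: "R l u x y \<Longrightarrow> (\<And>v. v \<in> {l..u} \<Longrightarrow> x' v = x v \<and> y' v = y v) \<Longrightarrow> R l u x' y'"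
    and cont_x: "R l u x y \<Longrightarrow> continuous_on {l..u} x"
    and cont_y: "R l u x y \<Longrightarrow> continuous_on {l..u} y"
    and nonconst: "R l u x y \<Longrightarrow> l < u \<Longrightarrow> \<exists>v\<in>{l..u}. y v \<noteq> c"
    and par: "R l u x1 y1 \<Longrightarrow> R l u x2 y2 \<Longrightarrow> (\<And>v. v \<in> {l..u} \<Longrightarrow> y1 v * y2 v \<noteq> 1) \<Longrightarrow>
      R l u (\<lambda>v. 1 + q / (y1 v * y2 v - 1)) (\<lambda>v. y1 v * y2 v)"
    and ser: "R l u x1 y1 \<Longrightarrow> R l u x2 y2 \<Longrightarrow> (\<And>v. v \<in> {l..u} \<Longrightarrow> x1 v * x2 v \<noteq> 1) \<Longrightarrow>
      R l u (\<lambda>v. x1 v * x2 v) (\<lambda>v. 1 + q / (x1 v * x2 v - 1))"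
    and root: "R l u x y \<Longrightarrow> v \<in> {l..u} \<Longrightarrow> x v = 0 \<or> y v = 0 \<Longrightarrow> root v"
begin

lemma x_eq: "R l u x y \<Longrightarrow> v \<in> {l..u} \<Longrightarrow> x v = 1 + q / (y v - 1)"
  using rel[of l u x y v] q0 by (cases "y v = 1") (auto simp: field_simps)

lemma dual: "weights q (\<lambda>l u x y. R l u y x) root"
proof
  fix l u x y c assume R: "R l u y x" "l < (u::real)"
  show "\<exists>v\<in>{l..u}. y v \<noteq> c"
  proof (rule ccontr)
    assume "\<not> ?thesis"
    then have c: "y v = c" if "v \<in> {l..u}" for v using that by auto
    \<comment> \<open>The relation between the coordinates would carry a constant value of one over
      to the other.\<close>
    have "x v = 1 + q / (c - 1)" if "v \<in> {l..u}" for v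
      using rel[OF R(1) that] q0 c[OF that] by (cases "c = 1") (auto simp: field_simps)
    then show False using nonconst[OF R, of "1 + q / (c - 1)"] by auto
  qed
next
  fix l u x y x' y' assume A: "R l u y x" "\<And>v. v \<in> {l..u} \<Longrightarrow> x' v = x v \<and> y' v = y v"
  show "R l u y' x'" by (rule cong[OF A(1)]) (use A(2) in auto)
next
  fix l u x y v assume "R l u y x" "v \<in> {l..u}"
  then show "(x v - 1) * (y v - 1) = q" using rel[of l u y x v] by (simp add: mult.commute)
qed (use q0 sub cont_x cont_y par ser root in auto)

text \<open>This is why \<open>1 - q\<close> serves as the target for \<open>x\<close>.\<close>

lemma y_eq_0:
  assumes "R l u x y" "v \<in> {l..u}" "x v = 1 - q"
  shows "y v = 0"
proof -
  have "(1 - q - 1) * (y v - 1) = q - q * y v" by (simp add: algebra_simps)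
  then have "q * y v = 0" using rel[OF assms(1,2)] unfolding assms(3) by simp
  then show ?thesis using q0 by simp
qed

lemma par_power:
  assumes R: "R l u x y" and ne: "\<And>v. v \<in> {l..u} \<Longrightarrow> \<bar>y v\<bar> \<noteq> 1" and "n \<ge> 1"
  shows "R l u (\<lambda>v. 1 + q / (y v ^ n - 1)) (\<lambda>v. y v ^ n)"
  using \<open>n \<ge> 1\<close>
proof (induction n rule: nat_induct_at_least)
  case base
  show ?case by (rule cong[OF R]) (simp add: x_eq[OF R])
next
  case (Suc n)
  have "y v * y v ^ n \<noteq> 1" if "v \<in> {l..u}" for v
    using ne[OF that] power_eq_1_iff[of "y v" "Suc n"] by auto
  then show ?case using par[OF R Suc.IH] by simp
qed

lemma ser_power:
  assumes "R l u x y" "\<And>v. v \<in> {l..u} \<Longrightarrow> \<bar>x v\<bar> \<noteq> 1" "n \<ge> 1"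
  shows "R l u (\<lambda>v. x v ^ n) (\<lambda>v. 1 + q / (x v ^ n - 1))"
proof -
  interpret d: weights q "\<lambda>l u x y. R l u y x" root by (rule dual)
  show ?thesis using d.par_power[OF assms] .
qed

text \<open>Parallel powers give factors close to 1, and a series power of these reaches
  \<open>s\<close>. The two points to be compared exist because \<open>y\<close> is not
  constant.\<close>

lemma reach_target:
  assumes R: "R l u x y" and lu: "l < u" and y: "\<And>v. v \<in> {l..u} \<Longrightarrow> y v < -1"
    and s: "continuous_on {l..u} s" "\<And>v. v \<in> {l..u} \<Longrightarrow> 0 < s v \<and> s v \<noteq> 1"
  obtains v x' y' where "v \<in> {l..u}" "R l u x' y'" "x' v = s v"
proof -
  obtain p where p: "p \<in> {l..u}" "y p \<noteq> y l" using nonconst[OF R lu] by blast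
  obtain p r where pr: "p \<in> {l..u}" "r \<in> {l..u}" "y r < y p"
    using p lu by (cases "y p < y l") (force simp: not_less_iff_gr_or_eq)+
  obtain v n k where vnk: "v \<in> {l..u}" "n \<ge> 1" "k \<ge> 1"
    "\<And>w. w \<in> {l..u} \<Longrightarrow> 0 < 1 + q / (y w ^ n - 1) \<and> 1 + q / (y w ^ n - 1) \<noteq> 1"
    "(1 + q / (y v ^ n - 1)) ^ k = s v"
    using crossing[OF cont_y[OF R] s(1) y s(2) q0 pr] by blast
  have "R l u (\<lambda>v. 1 + q / (y v ^ n - 1)) (\<lambda>v. y v ^ n)"
    using vnk(2) y by (intro par_power[OF R]) (force simp: abs_if)+
  then have "R l u (\<lambda>v. (1 + q / (y v ^ n - 1)) ^ k)
      (\<lambda>v. 1 + q / ((1 + q / (y v ^ n - 1)) ^ k - 1))"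
    using vnk(3,4) by (intro ser_power) force+
  with vnk that show ?thesis by blast
qed

text \<open>The target \<open>(1 - q) / xB v\<close> is positive, and reaching it makes the series
  composition with the partner have \<open>x = 1 - q\<close>. If the target is 1, the partner alone
  gives the root.\<close>

lemma root_with_partner:
  assumes R: "R l u x y" and lu: "l < u" and y: "\<And>v. v \<in> {l..u} \<Longrightarrow> y v < -1"
    and B: "R l u xB yB" and xB: "\<And>v. v \<in> {l..u} \<Longrightarrow> xB v < 0" and q: "1 < q"
  shows "\<exists>v\<in>{l..u}. root v"
proof (cases "\<exists>v\<in>{l..u}. xB v = 1 - q")
  case True
  then obtain v where v: "v \<in> {l..u}" "xB v = 1 - q" by blast
  then have "yB v = 0" using y_eq_0[OF B] v by blast
  then show ?thesis using root[OF B v(1)] v(1) by blast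
next
  case False
  have "continuous_on {l..u} (\<lambda>v. (1 - q) / xB v)"
    using xB by (intro continuous_intros cont_x[OF B]) force
  moreover have "0 < (1 - q) / xB v \<and> (1 - q) / xB v \<noteq> 1" if "v \<in> {l..u}" for v
    using xB[OF that] False that q by (auto simp: zero_less_divide_iff)
  ultimately obtain v x' y' where v: "v \<in> {l..u}" "R l u x' y'" "x' v = (1 - q) / xB v"
    using reach_target[OF R lu y] by blast
  have eq: "x' v * xB v = 1 - q" using v xB[OF v(1)] by simp
  \<comment> \<open>The one-point interval confines the side condition of \<open>ser\<close> to
    \<open>v\<close>.\<close>
  have "R v v (\<lambda>v. x' v * xB v) (\<lambda>v. 1 + q / (x' v * xB v - 1))"
    using v(1) eq q by (intro ser[OF sub[OF v(2)] sub[OF B]]) auto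
  moreover have "1 + q / (x' v * xB v - 1) = 0" using eq q by simp
  ultimately show ?thesis using root[of v v] v(1) by fastforce
qed

text \<open>For \<open>q < 1\<close> the target \<open>1 - q\<close> is reached directly. For
  \<open>1 < q\<close> the graph supplies its own partner: a long series power moves
  \<open>y\<close> between -1 and 0, and squaring this \<open>y\<close> in parallel makes
  \<open>x\<close> negative.\<close>

lemma root_of_small_q:
  assumes R: "R l u x y" and lu: "l < u" and y: "\<And>v. v \<in> {l..u} \<Longrightarrow> y v < -1"
    and q: "q < 2" "q \<noteq> 1"
  shows "\<exists>v\<in>{l..u}. root v"
proof (cases "q < 1")
  case True
  obtain v x' y' where v: "v \<in> {l..u}" "R l u x' y'" "x' v = 1 - q"
    using reach_target[OF R lu y, of "\<lambda>_. 1 - q"] True q0 by auto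
  have "y' v = 0" using y_eq_0[OF v(2,1,3)] .
  then show ?thesis using root[OF v(2,1)] v(1) by blast
next
  case False
  with q have q1: "1 < q" by simp
  have x: "1 - q / 2 < x v \<and> x v < 1" if v: "v \<in> {l..u}" for v
  proof -
    have "y v - 1 < 0" "q * (y v - 1) < q * - 2"
      using y[OF v] q1 mult_strict_left_mono[of "y v - 1" "- 2" q] by simp_all
    then have "- (q / 2) < q / (y v - 1)" "q / (y v - 1) < 0"
      using q1 by (simp_all add: neg_less_divide_eq divide_pos_neg)
    then show ?thesis using x_eq[OF R v] by linarith
  qed
  obtain m where m: "m \<in> {l..u}" "\<And>v. v \<in> {l..u} \<Longrightarrow> x v \<le> x m"
    using continuous_attains_sup[OF compact_Icc _ cont_x[OF R]] lu by auto
  have x0: "0 < x v" if "v \<in> {l..u}" for v using x[OF that] q by linarith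
  obtain n where n: "x m ^ n < 1 - q / 2"
    using real_arch_pow_inv[of "1 - q / 2" "x m"] x[OF m(1)] q by auto
  have n1: "n \<ge> 1" using n q1 by (cases n) auto
  let ?x = "\<lambda>v. x v ^ n" let ?y = "\<lambda>v. 1 + q / (?x v - 1)"
  have xn: "0 < ?x v \<and> ?x v < 1 - q / 2" if v: "v \<in> {l..u}" for v
  proof -
    have "?x v \<le> x m ^ n" using m(2)[OF v] x0[OF v] by (intro power_mono) auto
    then show ?thesis using n x0[OF v] by auto
  qed
  have yn: "- 1 < ?y v \<and> ?y v < 0" if v: "v \<in> {l..u}" for v
  proof -
    have "?x v - 1 < 0" using xn[OF v] q1 by linarith
    then have "- 2 < q / (?x v - 1)" "q / (?x v - 1) < - 1"
      using xn[OF v] q1 by (simp_all add: neg_less_divide_eq neg_divide_less_eq)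
    then show ?thesis by linarith
  qed
  have R1: "R l u ?x ?y"
    using x x0 n1 by (intro ser_power[OF R]) force+
  have R2: "R l u (\<lambda>v. 1 + q / (?y v ^ 2 - 1)) (\<lambda>v. ?y v ^ 2)"
    using yn by (intro par_power[OF R1]) force+
  have less: "q / (t - 1) < - 1" if "0 < t" "t < 1" for t
    using that q1 by (simp add: neg_divide_less_eq)
  have "1 + q / (?y v ^ 2 - 1) < 0" if v: "v \<in> {l..u}" for v
  proof -
    have "\<bar>?y v\<bar> < 1" "?y v \<noteq> 0" using yn[OF v] by auto
    then have "?y v ^ 2 < 1" "0 < ?y v ^ 2" by (blast intro: abs_square_less_1[THEN iffD2] zero_less_power2[THEN iffD2])+
    then have "q / (?y v ^ 2 - 1) < - 1" by (rule less[rotated])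
    then show ?thesis by simp
  qed
  then show ?thesis using root_with_partner[OF R lu y R2] q1 by blast
qed

lemma root_near_small_q:
  assumes R: "R l u x y" and lu: "l < u" and v: "v \<in> {l..u}" "y v < -1" and q: "q < 2" "q \<noteq> 1"
  shows "\<exists>v\<in>{l..u}. root v"
proof -
  obtain l' u' where *: "l \<le> l'" "l' < u'" "u' \<le> u" "\<And>w. w \<in> {l'..u'} \<Longrightarrow> y w < -1"
    using continuous_on_subinterval[OF cont_y[OF R] lu v] by blast
  then show ?thesis
    using root_of_small_q[OF sub[OF R *(1,3)] *(2,4) q] by force
qed

end

text \<open>The diamond operation maps the weight \<open>w\<close> to \<open>(1 + w\<^sup>2 / (q + 2 * w))\<^sup>2 - 1\<close> and its fixed
  points are the zeros of \<open>w ^ 3 - 2 * q * w - q\<^sup>2\<close>. Where this polynomial is negative the weights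
  grow by at least a fixed amount with every iteration, until \<open>x\<close> or \<open>y\<close> drops below \<open>-1\<close>.\<close>

lemma (in weights) root_diamond:
  assumes q: "0 < q" "q < 2" "q \<noteq> 1" and w0: "w0 < 0"
    and neg: "\<And>t. w0 \<le> t \<Longrightarrow> t < 0 \<Longrightarrow> t ^ 3 - 2 * q * t - q\<^sup>2 < 0"
    and R: "R l u x y" and lu: "l < u" and y: "\<And>v. v \<in> {l..u} \<Longrightarrow> w0 \<le> y v - 1 \<and> y v < 1"
  shows "\<exists>v\<in>{l..u}. root v"
proof -
  interpret d: weights q "\<lambda>l u x y. R l u y x" root by (rule dual)
  let ?f = "\<lambda>t. t * (t ^ 3 - 2 * q * t - q\<^sup>2)"
  \<comment> \<open>\<open>e\<close> is a gain in weight guaranteed for every diamond step that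
    starts below \<open>- q / 2\<close>.\<close>
  obtain e where e: "e > 0" "\<And>t. w0 \<le> t \<Longrightarrow> t < - q / 2 \<Longrightarrow> e \<le> ?f t / (q + 2 * t)\<^sup>2"
  proof (cases "w0 < - q / 2")
    case True
    have "continuous_on {w0..- q / 2} ?f" by (intro continuous_intros)
    then obtain m where m: "m \<in> {w0..- q / 2}" "\<And>t. t \<in> {w0..- q / 2} \<Longrightarrow> ?f m \<le> ?f t"
      using continuous_attains_inf[of "{w0..- q / 2}" ?f] True by auto
    have fm: "0 < ?f m" using neg[of m] m(1) q by (intro mult_neg_neg) auto
    show ?thesis
    proof (rule that[of "?f m / (q + 2 * w0)\<^sup>2"])
      show "0 < ?f m / (q + 2 * w0)\<^sup>2" using fm True by (intro divide_pos_pos) auto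
      fix t assume t: "w0 \<le> t" "t < - q / 2"
      have "(q + 2 * t)\<^sup>2 \<le> (q + 2 * w0)\<^sup>2"
        using t True by (intro abs_le_square_iff[THEN iffD1]) auto
      then show "?f m / (q + 2 * w0)\<^sup>2 \<le> ?f t / (q + 2 * t)\<^sup>2"
        using m(2)[of t] t fm by (intro frac_le) auto
    qed
  next
    case False
    show ?thesis by (rule that[of 1]) (use False in auto)
  qed
  \<comment> \<open>A weight above \<open>- q / 2\<close> means \<open>x < -1\<close>, which the
    dual argument settles; otherwise some weight lies strictly below, by nonconstancy.\<close>
  have first: "(\<exists>v\<in>{l..u}. root v) \<or> (\<exists>v\<in>{l..u}. y v - 1 < - q / 2)"
    if R: "R l u x y" and lu: "l < u" and y: "\<And>v. v \<in> {l..u} \<Longrightarrow> y v < 1" for l u x y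
  proof (cases "\<exists>v\<in>{l..u}. y v - 1 > - q / 2")
    case True
    then obtain v where v: "v \<in> {l..u}" "y v - 1 > - q / 2" by blast
    have "q / (y v - 1) < - 2" using v(2) y[OF v(1)] by (simp add: neg_divide_less_eq)
    then have "x v < -1" using x_eq[OF R v(1)] by linarith
    then show ?thesis using d.root_near_small_q[OF R lu v(1)] q by blast
  next
    case False
    obtain v where "v \<in> {l..u}" "y v \<noteq> 1 - q / 2" using nonconst[OF R lu] by blast
    with False show ?thesis by force
  qed
  \<comment> \<open>\<open>N\<close> bounds the number of diamond steps that lift all weights to at
    least \<open>- q / 2\<close>.\<close>
  have main: "\<exists>v\<in>{l..u}. root v"
    if "R l u x y" "l < u" "\<And>v. v \<in> {l..u} \<Longrightarrow> w0 \<le> y v - 1 \<and> y v < 1 \<and> - q / 2 - real N * e \<le> y v - 1"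
    for N l u x y
    using that
  proof (induction N arbitrary: l u x y)
    case 0
    then show ?case using first[OF 0(1,2)] by force
  next
    case (Suc N)
    note R = Suc.prems(1) and lu = Suc.prems(2) and y = Suc.prems(3)
    show ?case
    proof (rule ccontr)
      assume no_root: "\<not> ?case"
      then obtain v0 where "v0 \<in> {l..u}" "y v0 < 1 - q / 2"
        using first[OF R lu] y by force
      from continuous_on_subinterval[OF cont_y[OF R] lu this]
      obtain l1 u1 where 1: "l \<le> l1" "l1 < u1" "u1 \<le> u" "\<And>v. v \<in> {l1..u1} \<Longrightarrow> y v < 1 - q / 2"
        by blast
      have in1: "v \<in> {l..u}" if "v \<in> {l1..u1}" for v using that 1 by auto
      have R1: "R l1 u1 x y" using sub[OF R 1(1,3)] .
      have x1: "\<bar>x v\<bar> < 1" if v: "v \<in> {l1..u1}" for v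
      proof -
        have "y v - 1 < 0" using 1(4)[OF v] q by linarith
        then have "- 2 < q / (y v - 1)" "q / (y v - 1) < 0"
          using 1(4)[OF v] q by (simp_all add: neg_less_divide_eq divide_pos_neg)
        then show ?thesis using x_eq[OF R1 v] by linarith
      qed
      let ?y = "\<lambda>v. 1 + q / (x v ^ 2 - 1)"
      have sq: "0 \<le> x v ^ 2 \<and> x v ^ 2 < 1" if "v \<in> {l1..u1}" for v
        using x1[OF that] by (simp add: abs_square_less_1)
      have R2: "R l1 u1 (\<lambda>v. x v ^ 2) ?y"
        using x1 by (intro ser_power[OF R1]) force+
      have y_lt: "?y v < 1" "?y v \<le> 1 - q" if v: "v \<in> {l1..u1}" for v
      proof -
        have neg: "x v ^ 2 - 1 < 0" using sq[OF v] by simp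
        have "q * (1 - x v ^ 2) \<le> q * 1" using sq[OF v] q by (intro mult_left_mono) auto
        with neg have "q / (x v ^ 2 - 1) < 0" "q / (x v ^ 2 - 1) \<le> - q"
          using q by (simp_all add: divide_pos_neg neg_divide_le_eq algebra_simps)
        then show "?y v < 1" "?y v \<le> 1 - q" by linarith+
      qed
      \<comment> \<open>A value below -1 would already give a root. Nonconstancy then allows
        shrinking to an interval where \<open>?y\<close> is strictly between -1 and 1, as squaring
        it in parallel requires.\<close>
      have y_ge: "- 1 \<le> ?y v" if v: "v \<in> {l1..u1}" for v
        using root_near_small_q[OF R2 1(2) v] q no_root in1 by force
      obtain v1 where v1: "v1 \<in> {l1..u1}" "?y v1 \<noteq> - 1" using nonconst[OF R2 1(2)] by blast
      then have "- ?y v1 < 1" using y_ge[OF v1(1)] by linarith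
      moreover have "continuous_on {l1..u1} (\<lambda>v. - ?y v)"
        using cont_y[OF R2] by (rule continuous_on_minus)
      ultimately obtain l2 u2 where 2: "l1 \<le> l2" "l2 < u2" "u2 \<le> u1" "\<And>v. v \<in> {l2..u2} \<Longrightarrow> - ?y v < 1"
        using continuous_on_subinterval[of l1 u1 "\<lambda>v. - ?y v" v1 1] 1(2) v1(1) by blast
      have in2: "v \<in> {l1..u1}" if "v \<in> {l2..u2}" for v using that 2 by auto
      have y2: "\<bar>?y v\<bar> < 1" if v: "v \<in> {l2..u2}" for v
        using 2(4)[OF v] y_lt(1)[OF in2[OF v]] by linarith
      have R3: "R l2 u2 (\<lambda>v. 1 + q / (?y v ^ 2 - 1)) (\<lambda>v. ?y v ^ 2)"
        using y2 by (intro par_power[OF sub[OF R2 2(1,3)]]) force+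
      \<comment> \<open>The gain is positive because both the weight and the cubic are
        negative.\<close>
      have grow: "?y v ^ 2 - 1 = (y v - 1) + ?f (y v - 1) / (q + 2 * (y v - 1))\<^sup>2" if v: "v \<in> {l2..u2}" for v
      proof -
        define w where "w = y v - 1"
        have w: "w \<noteq> 0" "q + 2 * w \<noteq> 0" using 1(4)[OF in2[OF v]] q by (auto simp: w_def)
        have "x v = 1 + q / w" using x_eq[OF R1 in2[OF v]] by (simp add: w_def)
        then have "x v ^ 2 - 1 = q * (q + 2 * w) / w\<^sup>2"
          using w by (simp add: field_simps power2_eq_square)
        then have Y: "?y v = 1 + w\<^sup>2 / (q + 2 * w)" using q w by simp
        show ?thesis
          unfolding w_def[symmetric] Y using w
          by (simp add: power2_eq_square power3_eq_cube divide_simps) algebra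
      qed
      have "\<exists>v\<in>{l2..u2}. root v"
      proof (rule Suc.IH[OF R3 2(2)])
        fix v assume v: "v \<in> {l2..u2}"
        note v' = in1[OF in2[OF v]]
        have "e \<le> ?f (y v - 1) / (q + 2 * (y v - 1))\<^sup>2"
          using e(2)[of "y v - 1"] y[OF v'] 1(4)[OF in2[OF v]] by simp
        moreover have "?y v ^ 2 < 1" using y2[OF v] by (simp add: abs_square_less_1)
        ultimately show "w0 \<le> ?y v ^ 2 - 1 \<and> ?y v ^ 2 < 1 \<and> - q / 2 - real N * e \<le> ?y v ^ 2 - 1"
          using grow[OF v] y[OF v'] e(1) by (simp add: algebra_simps)
      qed
      then show False using no_root in1 in2 by blast
    qed
  qed
  obtain N where "- q / 2 - w0 \<le> real N * e"
    using reals_Archimedean3[OF e(1)] by (meson less_imp_le)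
  then show ?thesis using main[OF R lu, of N] y by force
qed

subsection \<open>Zeros on vertical segments\<close>

lemma real_polynomial_function_eq_0:
  fixes p :: "real \<Rightarrow> real"
  assumes "real_polynomial_function p" "infinite {x. p x = 0}"
  shows "p x = 0"
proof -
  obtain c n where p: "p = (\<lambda>x. \<Sum>i\<le>n. c i * x ^ i)"
    using assms(1) real_polynomial_function_iff_sum by blast
  then have "\<forall>i\<le>n. c i = 0"
    using assms(2) polyfun_finite_roots[of c n] by auto
  then show ?thesis by (simp add: p)
qed

definition realized ::
  "real \<Rightarrow> real \<Rightarrow> real \<Rightarrow> (real \<Rightarrow> real) \<Rightarrow> (real \<Rightarrow> real) \<Rightarrow> bool" where
  "realized q l u x y \<longleftrightarrow> (\<exists>a b. gadget q a b \<and>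
     (\<forall>v\<in>{l..u}. a v \<noteq> 0 \<and> b v \<noteq> 0 \<and> x v = (q * a v + b v) / b v \<and> y v = (a v + b v) / a v))"

lemma realized_edge: "0 < l \<or> u < 0 \<Longrightarrow> realized q l u (\<lambda>v. 1 + q / v) (\<lambda>v. 1 + v)"
  unfolding realized_def
  by (rule exI[of _ "\<lambda>v. 1"], rule exI[of _ "\<lambda>v. v"]) (auto simp: gadget_edge field_simps)

lemma weights_realized:
  assumes q: "q \<noteq> 0" "q \<noteq> 1"
  shows "weights q (realized q) (\<lambda>v. (q, v) \<in> tutte_zeros)"
proof
  fix l u x y v assume R: "realized q l u x y" "v \<in> {l..u}"
  then obtain a b :: real where "a \<noteq> 0" "b \<noteq> 0" "x v = (q * a + b) / b" "y v = (a + b) / a"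
    unfolding realized_def by blast
  then show "(x v - 1) * (y v - 1) = q" by (simp add: add_divide_distrib)
next
  fix l u x y l' u' assume "realized q l u x y" "l \<le> l'" "u' \<le> (u::real)"
  then show "realized q l' u' x y" unfolding realized_def by fastforce
next
  fix l u x y x' y' assume "realized q l u x y" "\<And>v. v \<in> {l..u} \<Longrightarrow> x' v = x v \<and> y' v = y v"
  then show "realized q l u x' y'" unfolding realized_def by simp
next
  fix l u x y assume "realized q l u x y"
  then obtain a b where g: "gadget q a b" "\<And>v. v \<in> {l..u} \<Longrightarrow> a v \<noteq> 0" "\<And>v. v \<in> {l..u} \<Longrightarrow> b v \<noteq> 0"
    "\<And>v. v \<in> {l..u} \<Longrightarrow> x v = (q * a v + b v) / b v"
    "\<And>v. v \<in> {l..u} \<Longrightarrow> y v = (a v + b v) / a v"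
    unfolding realized_def by blast
  have c: "continuous_on {l..u} a" "continuous_on {l..u} b"
    using g(1) unfolding gadget_def
    by (auto intro: continuous_at_imp_continuous_on continuous_real_polymonial_function)
  have "continuous_on {l..u} (\<lambda>v. (q * a v + b v) / b v)" "continuous_on {l..u} (\<lambda>v. (a v + b v) / a v)"
    using g(2,3) by (auto intro!: continuous_intros c)
  note xy = this
  show "continuous_on {l..u} x" by (rule continuous_on_eq[OF xy(1)]) (use g(4) in simp)
  show "continuous_on {l..u} y" by (rule continuous_on_eq[OF xy(2)]) (use g(5) in simp)
next
  fix l u x y c assume R: "realized q l u x y" "l < (u::real)"
  show "\<exists>v\<in>{l..u}. y v \<noteq> c"
  proof (rule ccontr)
    assume "\<not> ?thesis"
    then have c: "y v = c" if "v \<in> {l..u}" for v using that by auto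
    obtain a b where g: "gadget q a b" "\<And>v. v \<in> {l..u} \<Longrightarrow> a v \<noteq> 0" "\<And>v. v \<in> {l..u} \<Longrightarrow> b v \<noteq> 0"
      "\<And>v. v \<in> {l..u} \<Longrightarrow> y v = (a v + b v) / a v"
      using R(1) unfolding realized_def by blast
    \<comment> \<open>If \<open>y\<close> were constantly \<open>c\<close>, this polynomial would
      vanish on the interval and hence everywhere. Its value at 0 forces \<open>c = 1\<close>, and
      then \<open>b\<close> is identically 0.\<close>
    let ?p = "\<lambda>v. b v - (c - 1) * a v"
    have "?p v = 0" if "v \<in> {l..u}" for v
      using g(2)[OF that] g(4)[OF that] c[OF that] by (simp add: field_simps)
    then have "{l..u} \<subseteq> {v. ?p v = 0}" by blast
    moreover have "infinite {l..u}" using R(2) by (rule infinite_Icc)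
    ultimately have inf: "infinite {v. ?p v = 0}" using infinite_super by blast
    have "real_polynomial_function ?p"
      using g(1) unfolding gadget_def
      by (intro real_polynomial_function_diff real_polynomial_function.intros(2,4)) auto
    then have p: "?p v = 0" for v using real_polynomial_function_eq_0 inf by blast
    have "c = 1" using p[of 0] g(1) unfolding gadget_def by auto
    then show False using p[of l] g(3)[of l] R(2) by simp
  qed
next
  fix l u x1 y1 x2 y2
  assume R: "realized q l u x1 y1" "realized q l u x2 y2" and ne: "\<And>v. v \<in> {l..u} \<Longrightarrow> y1 v * y2 v \<noteq> 1"
  obtain a1 b1 where 1: "gadget q a1 b1" "\<And>v. v \<in> {l..u} \<Longrightarrow> a1 v \<noteq> 0"
    "\<And>v. v \<in> {l..u} \<Longrightarrow> y1 v = (a1 v + b1 v) / a1 v"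
    using R(1) unfolding realized_def by blast
  obtain a2 b2 where 2: "gadget q a2 b2" "\<And>v. v \<in> {l..u} \<Longrightarrow> a2 v \<noteq> 0"
    "\<And>v. v \<in> {l..u} \<Longrightarrow> y2 v = (a2 v + b2 v) / a2 v"
    using R(2) unfolding realized_def by blast
  let ?a = "\<lambda>v. a1 v * a2 v" and ?b = "\<lambda>v. (a1 v + b1 v) * (a2 v + b2 v) - a1 v * a2 v"
  have "gadget q ?a ?b" using gadget_par[OF 1(1) 2(1) q] .
  moreover have "?a v \<noteq> 0 \<and> ?b v \<noteq> 0 \<and> 1 + q / (y1 v * y2 v - 1) = (q * ?a v + ?b v) / ?b v
      \<and> y1 v * y2 v = (?a v + ?b v) / ?a v" if v: "v \<in> {l..u}" for v
  proof -
    have a: "?a v \<noteq> 0" using 1(2)[OF v] 2(2)[OF v] by simp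
    have y: "y1 v * y2 v = (?a v + ?b v) / ?a v" using 1(3)[OF v] 2(3)[OF v] by simp
    then have y': "y1 v * y2 v - 1 = ?b v / ?a v" using a by (simp add: diff_divide_distrib add_divide_distrib)
    then have b: "?b v \<noteq> 0" using ne[OF v] by auto
    have "1 + q / (?b v / ?a v) = (q * ?a v + ?b v) / ?b v" using b by (simp add: add_divide_distrib)
    then show ?thesis using a b y unfolding y' by blast
  qed
  ultimately show "realized q l u (\<lambda>v. 1 + q / (y1 v * y2 v - 1)) (\<lambda>v. y1 v * y2 v)"
    unfolding realized_def by blast
next
  fix l u x1 y1 x2 y2
  assume R: "realized q l u x1 y1" "realized q l u x2 y2" and ne: "\<And>v. v \<in> {l..u} \<Longrightarrow> x1 v * x2 v \<noteq> 1"
  obtain a1 b1 where 1: "gadget q a1 b1" "\<And>v. v \<in> {l..u} \<Longrightarrow> b1 v \<noteq> 0"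
    "\<And>v. v \<in> {l..u} \<Longrightarrow> x1 v = (q * a1 v + b1 v) / b1 v"
    using R(1) unfolding realized_def by blast
  obtain a2 b2 where 2: "gadget q a2 b2" "\<And>v. v \<in> {l..u} \<Longrightarrow> b2 v \<noteq> 0"
    "\<And>v. v \<in> {l..u} \<Longrightarrow> x2 v = (q * a2 v + b2 v) / b2 v"
    using R(2) unfolding realized_def by blast
  let ?a = "\<lambda>v. q * a1 v * a2 v + a1 v * b2 v + b1 v * a2 v" and ?b = "\<lambda>v. b1 v * b2 v"
  have "gadget q ?a ?b" using gadget_ser[OF 1(1) 2(1) q] .
  moreover have "?a v \<noteq> 0 \<and> ?b v \<noteq> 0 \<and> x1 v * x2 v = (q * ?a v + ?b v) / ?b v
      \<and> 1 + q / (x1 v * x2 v - 1) = (?a v + ?b v) / ?a v" if v: "v \<in> {l..u}" for v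
  proof -
    have b: "?b v \<noteq> 0" using 1(2)[OF v] 2(2)[OF v] by simp
    have x: "x1 v * x2 v = (q * ?a v + ?b v) / ?b v"
      using 1(3)[OF v] 2(3)[OF v] by (simp add: algebra_simps)
    then have x': "x1 v * x2 v - 1 = q * ?a v / ?b v" using b by (simp add: diff_divide_distrib add_divide_distrib)
    then have a: "?a v \<noteq> 0" using ne[OF v] by auto
    have "1 + q / (q * ?a v / ?b v) = (?a v + ?b v) / ?a v"
      using a q by (simp add: add_divide_distrib)
    then show ?thesis using a b x unfolding x' by blast
  qed
  ultimately show "realized q l u (\<lambda>v. x1 v * x2 v) (\<lambda>v. 1 + q / (x1 v * x2 v - 1))"
    unfolding realized_def by blast
next
  fix l u x y v assume R: "realized q l u x y" "v \<in> {l..u}" "x v = 0 \<or> y v = 0"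
  obtain a b where g: "gadget q a b" "a v \<noteq> 0" "b v \<noteq> 0"
    "x v = (q * a v + b v) / b v" "y v = (a v + b v) / a v"
    using R(1,2) unfolding realized_def by blast
  then have "q * a v + b v = 0 \<or> a v + b v = 0" using R(3) by auto
  then show "(q, v) \<in> tutte_zeros" using tutte_zeros_gadget[OF g(1)] by blast
qed (use q in auto)

text \<open>The gadget coefficients \<open>A\<close> and \<open>B\<close> share a factor that
  cancels, and \<open>q * A + B\<close> and \<open>A + B\<close> are proportional to
  \<open>(q - 1) * T\<close> and \<open>(q - 1) * M\<close>.\<close>

lemma realized_uniform:
  assumes R: "realized q l u x y" and L: "pairs_below (k + 2) L" and q: "q \<noteq> 0" "q \<noteq> 1"
  defines "T \<equiv> \<lambda>w. wZ q (k + 2) id (plain_edges w L)"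
    and "M \<equiv> \<lambda>w. wZ q (k + 2) (merge id 0 1) (plain_edges w L)"
  assumes ne: "\<And>v. v \<in> {l..u} \<Longrightarrow> T (y v - 1) \<noteq> M (y v - 1) \<and> q * M (y v - 1) \<noteq> T (y v - 1)"
  shows "realized q l u
    (\<lambda>v. (q - 1) * T (y v - 1) / (q * M (y v - 1) - T (y v - 1)))
    (\<lambda>v. (q - 1) * M (y v - 1) / (T (y v - 1) - M (y v - 1)))"
proof -
  obtain a b where g: "gadget q a b" "\<And>v. v \<in> {l..u} \<Longrightarrow> a v \<noteq> 0"
    "\<And>v. v \<in> {l..u} \<Longrightarrow> y v = (a v + b v) / a v"
    using R unfolding realized_def by blast
  obtain A B where AB: "gadget q A B"
    "\<And>v. a v \<noteq> 0 \<Longrightarrow> A v = a v ^ length L / (q * (q - 1)) * (T (b v / a v) - M (b v / a v))"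
    "\<And>v. a v \<noteq> 0 \<Longrightarrow> B v = a v ^ length L / (q * (q - 1)) * (q * M (b v / a v) - T (b v / a v))"
    using gadget_uniform[OF g(1) L q] unfolding T_def M_def by blast
  show ?thesis
    unfolding realized_def
  proof (rule exI[of _ A], rule exI[of _ B], intro conjI ballI AB(1))
    fix v assume v: "v \<in> {l..u}"
    define c where "c = a v ^ length L / (q * (q - 1))"
    have c: "c \<noteq> 0" using q g(2)[OF v] by (simp add: c_def)
    have w: "b v / a v = y v - 1" using g(2,3)[OF v] by (simp add: field_simps)
    have A: "A v = c * (T (y v - 1) - M (y v - 1))" and B: "B v = c * (q * M (y v - 1) - T (y v - 1))"
      using AB(2,3)[OF g(2)[OF v]] by (simp_all add: c_def w)
    show A0: "A v \<noteq> 0" and B0: "B v \<noteq> 0" using ne[OF v] c by (simp_all add: A B)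
    have "q * A v + B v = c * ((q - 1) * T (y v - 1))" "A v + B v = c * ((q - 1) * M (y v - 1))"
      by (simp_all add: A B algebra_simps)
    then show "(q - 1) * T (y v - 1) / (q * M (y v - 1) - T (y v - 1)) = (q * A v + B v) / B v"
      "(q - 1) * M (y v - 1) / (T (y v - 1) - M (y v - 1)) = (A v + B v) / A v"
      using c by (simp_all add: A B)
  qed
qed

section \<open>Amplification by near-cliques and the Petersen graph\<close>

lemma isCont_tendsto_nhds: "isCont f a \<Longrightarrow> (f \<longlongrightarrow> f a) (nhds a)"
  unfolding isCont_def by (rule tendsto_at_iff_tendsto_nhds[THEN iffD1])

text \<open>With \<open>k\<close> the floor of \<open>q\<close>, the quotient at weight -1 is
  \<open>(q - 1) / (q - (k + 1))\<close>, below -1 since \<open>0 < k + 1 - q < 1 < q - 1\<close>.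
  Continuity extends this to nearby weights.\<close>

lemma clique_amplifies:
  assumes q: "2 < q" "q \<notin> \<int>"
  obtains k e where "0 < e"
    "\<And>w. \<bar>w + 1\<bar> < e \<Longrightarrow>
      wZ q (k + 2) id (plain_edges w (near_clique k)) \<noteq>
        wZ q (k + 2) (merge id 0 1) (plain_edges w (near_clique k)) \<and>
      (q - 1) * wZ q (k + 2) (merge id 0 1) (plain_edges w (near_clique k)) /
        (wZ q (k + 2) id (plain_edges w (near_clique k)) -
         wZ q (k + 2) (merge id 0 1) (plain_edges w (near_clique k))) < -1"
proof -
  define k where "k = nat \<lfloor>q\<rfloor>"
  let ?T = "\<lambda>w. wZ q (k + 2) id (plain_edges w (near_clique k))"
  let ?M = "\<lambda>w. wZ q (k + 2) (merge id 0 1) (plain_edges w (near_clique k))"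
  have rk: "real k = of_int \<lfloor>q\<rfloor>" using q by (simp add: k_def)
  have "of_int \<lfloor>q\<rfloor> \<noteq> q" using q by (metis Ints_of_int)
  moreover have "2 \<le> \<lfloor>q\<rfloor>" using q by (simp add: le_floor_iff)
  ultimately have k: "real k < q" "q < real k + 1" "2 \<le> real k"
    using q rk by linarith+
  have M: "?M (-1) = (\<Prod>i<k + 1. q - real i)" by (rule Z_near_clique_merged)
  have M0: "?M (-1) > 0" unfolding M using k by (intro prod_pos) auto
  have TM: "?T (-1) - ?M (-1) = ?M (-1) * (q - (real k + 1))"
  proof -
    have "?T (-1) - ?M (-1) = (\<Prod>i<k + 2. q - real i)" by (rule Z_near_clique_diff)
    also have "\<dots> = (\<Prod>i<k + 1. q - real i) * (q - (real k + 1))" by (simp add: algebra_simps)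
    finally show ?thesis unfolding M .
  qed
  have TM0: "?T (-1) - ?M (-1) \<noteq> 0" unfolding TM using M0 k by simp
  have "(q - 1) * ?M (-1) / (?T (-1) - ?M (-1)) = (q - 1) / (q - (real k + 1))"
    unfolding TM using M0 by simp
  also have "\<dots> < -1"
    using k by (simp add: neg_divide_less_eq)
  finally have y: "(q - 1) * ?M (-1) / (?T (-1) - ?M (-1)) < -1" .
  have cD: "isCont (\<lambda>w. ?T w - ?M w) (-1)" by (intro continuous_intros continuous_Z_plain)
  have "isCont (\<lambda>w. (q - 1) * ?M w / (?T w - ?M w)) (-1)"
    using TM0 by (intro continuous_intros continuous_Z_plain)
  then have "\<forall>\<^sub>F w in nhds (-1). (q - 1) * ?M w / (?T w - ?M w) < -1"
    by (rule order_tendstoD(2)[OF isCont_tendsto_nhds]) (rule y)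
  moreover have "\<forall>\<^sub>F w in nhds (-1). ?T w - ?M w \<noteq> 0"
    by (rule tendsto_imp_eventually_ne[OF isCont_tendsto_nhds[OF cD] TM0])
  ultimately have "\<forall>\<^sub>F w in nhds (-1). ?T w \<noteq> ?M w \<and> (q - 1) * ?M w / (?T w - ?M w) < -1"
    by eventually_elim simp
  then obtain e where "0 < e" "\<And>w. dist w (-1) < e \<Longrightarrow> ?T w \<noteq> ?M w \<and> (q - 1) * ?M w / (?T w - ?M w) < -1"
    unfolding eventually_nhds_metric by blast
  then show ?thesis using that[of e k] by (simp add: dist_real_def)
qed

text \<open>At weight \<open>- q\<close> the common factors of the two flow polynomials cancel, and
  \<open>q - 4\<close> is the only negative factor left.\<close>

lemma petersen_amplifies:
  assumes q: "2 < q" "q < 4" "q \<noteq> 3"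
  obtains e where "0 < e"
    "\<And>w. \<bar>w + q\<bar> < e \<Longrightarrow>
      q * wZ q (8 + 2) (merge id 0 1) (plain_edges w petersen_minus) \<noteq>
        wZ q (8 + 2) id (plain_edges w petersen_minus) \<and>
      (q - 1) * wZ q (8 + 2) id (plain_edges w petersen_minus) /
        (q * wZ q (8 + 2) (merge id 0 1) (plain_edges w petersen_minus) -
         wZ q (8 + 2) id (plain_edges w petersen_minus)) < 0"
proof -
  let ?T = "\<lambda>w. wZ q (8 + 2) id (plain_edges w petersen_minus)"
  let ?M = "\<lambda>w. wZ q (8 + 2) (merge id 0 1) (plain_edges w petersen_minus)"
  let ?D = "\<lambda>w. q * ?M w - ?T w"
  define c where "c = q ^ 10 * ((q - 1) * (q - 2) * (q - 3))"
  have c: "c \<noteq> 0" using q by (simp add: c_def)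
  have T: "?T (- q) = c * ((q - 3)\<^sup>2 + 2)" by (simp only: Z_petersen c_def mult_ac)
  have D: "?D (- q) = c * ((q - 4) * (q\<^sup>2 - 5 * q + 10))"
    by (simp only: Z_petersen_merged c_def mult_ac)
  have "q\<^sup>2 - 5 * q + 10 = (q - 5 / 2)\<^sup>2 + 15 / 4" by (simp add: power2_eq_square algebra_simps)
  then have pos: "q\<^sup>2 - 5 * q + 10 > 0" by (simp add: add_nonneg_pos)
  then have neg: "(q - 4) * (q\<^sup>2 - 5 * q + 10) < 0" using q by (intro mult_neg_pos) auto
  have D0: "?D (- q) \<noteq> 0" unfolding D using c neg by (metis mult_eq_0_iff less_irrefl)
  have "(q - 1) * ?T (- q) / ?D (- q) = (q - 1) * ((q - 3)\<^sup>2 + 2) / ((q - 4) * (q\<^sup>2 - 5 * q + 10))"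
    by (subst D, subst T) (use c in simp)
  also have "\<dots> < 0"
    using q neg by (intro divide_pos_neg mult_pos_pos) (auto simp: add_nonneg_pos)
  finally have x: "(q - 1) * ?T (- q) / ?D (- q) < 0" .
  have cD: "isCont ?D (- q)" by (intro continuous_intros continuous_Z_plain)
  have "isCont (\<lambda>w. (q - 1) * ?T w / ?D w) (- q)"
    using D0 by (intro continuous_intros continuous_Z_plain)
  then have "\<forall>\<^sub>F w in nhds (- q). (q - 1) * ?T w / ?D w < 0"
    by (rule order_tendstoD(2)[OF isCont_tendsto_nhds]) (rule x)
  moreover have "\<forall>\<^sub>F w in nhds (- q). ?D w \<noteq> 0"
    by (rule tendsto_imp_eventually_ne[OF isCont_tendsto_nhds[OF cD] D0])
  ultimately have "\<forall>\<^sub>F w in nhds (- q). q * ?M w \<noteq> ?T w \<and> (q - 1) * ?T w / ?D w < 0"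
    by eventually_elim simp
  then obtain e where "0 < e" "\<And>w. dist w (- q) < e \<Longrightarrow> q * ?M w \<noteq> ?T w \<and> (q - 1) * ?T w / ?D w < 0"
    unfolding eventually_nhds_metric by blast
  then show ?thesis using that[of e] by (simp add: dist_real_def)
qed

section \<open>Segments in the individual ranges of q and v\<close>

lemma zero_beyond_2:
  assumes "q < 2" "q \<noteq> 0" "q \<noteq> 1" "l < u" "u < -2"
  shows "\<exists>v\<in>{l..u}. (q, v) \<in> tutte_zeros"
proof -
  interpret weights q "realized q" "\<lambda>v. (q, v) \<in> tutte_zeros" using assms by (intro weights_realized)
  show ?thesis using root_of_small_q[OF realized_edge[of l u q]] assms by auto
qed

text \<open>A single edge has \<open>x < -1\<close> here, so the argument applies with the
  coordinates exchanged.\<close>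

lemma zero_ferromagnetic:
  assumes "q < 0" "0 < l" "l < u" "u < - q / 2"
  shows "\<exists>v\<in>{l..u}. (q, v) \<in> tutte_zeros"
proof -
  interpret weights q "realized q" "\<lambda>v. (q, v) \<in> tutte_zeros" using assms by (intro weights_realized) auto
  interpret d: weights q "\<lambda>l u x y. realized q l u y x" "\<lambda>v. (q, v) \<in> tutte_zeros" by (rule dual)
  have "1 + q / v < - 1" if "v \<in> {l..u}" for v
  proof -
    have "q / v < - 2" using that assms by (simp add: pos_divide_less_eq)
    then show ?thesis by simp
  qed
  then show ?thesis using d.root_of_small_q[OF realized_edge[of l u q]] assms by auto
qed

lemma zero_diamond:
  assumes "0 < q" "q < 2" "q \<noteq> 1" "l < u" "u < 0"
    and "\<And>t. l \<le> t \<Longrightarrow> t < 0 \<Longrightarrow> t ^ 3 - 2 * q * t - q\<^sup>2 < 0"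
  shows "\<exists>v\<in>{l..u}. (q, v) \<in> tutte_zeros"
proof -
  interpret weights q "realized q" "\<lambda>v. (q, v) \<in> tutte_zeros" using assms by (intro weights_realized) auto
  show ?thesis by (rule root_diamond[OF _ _ _ _ _ realized_edge[of l u q], of l]) (use assms in auto)
qed

text \<open>After exchanging the coordinates an edge of weight \<open>v\<close> acts like one of
  weight \<open>q / v\<close>.\<close>

lemma zero_dual_diamond:
  assumes "0 < q" "q < 2" "q \<noteq> 1" "l < u" "u < 0" "w0 \<le> q / u"
    and "\<And>t. w0 \<le> t \<Longrightarrow> t < 0 \<Longrightarrow> t ^ 3 - 2 * q * t - q\<^sup>2 < 0"
  shows "\<exists>v\<in>{l..u}. (q, v) \<in> tutte_zeros"
proof -
  interpret weights q "realized q" "\<lambda>v. (q, v) \<in> tutte_zeros" using assms by (intro weights_realized) auto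
  interpret d: weights q "\<lambda>l u x y. realized q l u y x" "\<lambda>v. (q, v) \<in> tutte_zeros" by (rule dual)
  have neg: "q / v < 0" if "v \<in> {l..u}" for v using that assms by (auto intro: divide_pos_neg)
  have "w0 \<le> q / v" if "v \<in> {l..u}" for v
  proof -
    have "q / u \<le> q / v" using that assms by (intro divide_left_mono) (auto intro: mult_neg_neg)
    then show ?thesis using assms by linarith
  qed
  moreover have "w0 < 0" using neg[of u] assms by simp
  ultimately show ?thesis
    by (intro d.root_diamond[OF _ _ _ _ _ realized_edge[of l u q], of w0]) (use assms neg in auto)
qed

lemma edge_x_neg: "- q < v \<Longrightarrow> v < 0 \<Longrightarrow> 1 + q / v < (0::real)"
proof -
  assume "- q < v" "v < 0"
  then have "q / v < - 1" by (simp add: neg_divide_less_eq)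
  then show ?thesis by simp
qed

text \<open>A single edge has both \<open>y < -1\<close> and \<open>x < 0\<close> and is its own
  partner.\<close>

lemma zero_between:
  assumes "2 < q" "- q < l" "l < u" "u < -2"
  shows "\<exists>v\<in>{l..u}. (q, v) \<in> tutte_zeros"
proof -
  interpret weights q "realized q" "\<lambda>v. (q, v) \<in> tutte_zeros" using assms by (intro weights_realized) auto
  have R: "realized q l u (\<lambda>v. 1 + q / v) (\<lambda>v. 1 + v)" using assms by (intro realized_edge) auto
  show ?thesis by (rule root_with_partner[OF R _ _ R]) (use assms in \<open>auto intro: edge_x_neg\<close>)
qed

text \<open>Since \<open>\<bar>1 + v\<bar> < 1\<close>, many parallel edges have weight close to -1,
  where the near-clique has \<open>y < -1\<close>. A single edge, with \<open>x < 0\<close>, is the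
  partner.\<close>

lemma zero_clique:
  assumes q: "2 < q" "q \<notin> \<int>" and lu: "-2 < l" "l < u" "u < 0"
  shows "\<exists>v\<in>{l..u}. (q, v) \<in> tutte_zeros"
proof -
  interpret weights q "realized q" "\<lambda>v. (q, v) \<in> tutte_zeros" using q by (intro weights_realized) auto
  obtain k e where e: "0 < e"
    "\<And>w. \<bar>w + 1\<bar> < e \<Longrightarrow>
      wZ q (k + 2) id (plain_edges w (near_clique k)) \<noteq>
        wZ q (k + 2) (merge id 0 1) (plain_edges w (near_clique k)) \<and>
      (q - 1) * wZ q (k + 2) (merge id 0 1) (plain_edges w (near_clique k)) /
        (wZ q (k + 2) id (plain_edges w (near_clique k)) -
         wZ q (k + 2) (merge id 0 1) (plain_edges w (near_clique k))) < -1"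
    using clique_amplifies[OF q] by blast
  let ?T = "\<lambda>w. wZ q (k + 2) id (plain_edges w (near_clique k))"
  let ?M = "\<lambda>w. wZ q (k + 2) (merge id 0 1) (plain_edges w (near_clique k))"
  define m where "m = max \<bar>1 + l\<bar> \<bar>1 + u\<bar>"
  have m: "0 \<le> m" "m < 1" "\<And>v. v \<in> {l..u} \<Longrightarrow> \<bar>1 + v\<bar> \<le> m" using lu by (auto simp: m_def)
  obtain N where N: "m ^ N < e" using real_arch_pow_inv[OF e(1) m(2)] by blast
  have R: "realized q l u (\<lambda>v. 1 + q / v) (\<lambda>v. 1 + v)" using lu by (intro realized_edge) auto
  have RN: "realized q l u (\<lambda>v. 1 + q / ((1 + v) ^ Suc N - 1)) (\<lambda>v. (1 + v) ^ Suc N)"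
    using m by (intro par_power[OF R]) force+
  have small: "\<bar>(1 + v) ^ Suc N - 1 + 1\<bar> < e" if "v \<in> {l..u}" for v
  proof -
    have "\<bar>(1 + v) ^ Suc N - 1 + 1\<bar> = \<bar>1 + v\<bar> ^ Suc N" by (simp add: power_abs abs_mult)
    also have "\<dots> \<le> m ^ Suc N" using m(3)[OF that] by (intro power_mono) auto
    also have "\<dots> \<le> m ^ N" using m(1,2) by (intro power_decreasing) auto
    finally show ?thesis using N by simp
  qed
  have ne: "?T w \<noteq> ?M w \<and> q * ?M w \<noteq> ?T w" if "\<bar>w + 1\<bar> < e" for w
  proof -
    have False if eq: "q * ?M w = ?T w"
    proof -
      note * = e(2)[OF \<open>\<bar>w + 1\<bar> < e\<close>]
      have "(q - 1) * ?M w = ?T w - ?M w" using eq by (simp add: algebra_simps)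
      then have "(q - 1) * ?M w / (?T w - ?M w) = 1"
        using *[THEN conjunct1] by (simp only: divide_self right_minus_eq not_False_eq_True)
      then show False using * by linarith
    qed
    then show ?thesis using e(2)[OF that] by blast
  qed
  note R' = realized_uniform[OF RN near_clique_below[of k] _ _ ne[OF small]]
  show ?thesis
    by (rule root_with_partner[OF R' _ _ R]) (use q lu e(2)[OF small] in \<open>auto intro: edge_x_neg\<close>)
qed

text \<open>Here \<open>0 < 1 + q / v < 1\<close>, so a long path has weight close to
  \<open>- q\<close>, where the Petersen graph without an edge has \<open>x < 0\<close>. It is the
  partner of a single edge, which has \<open>y < -1\<close>.\<close>

lemma zero_petersen:
  assumes q: "2 < q" "q < 4" "q \<noteq> 3" and lu: "l < u" "u < - q"
  shows "\<exists>v\<in>{l..u}. (q, v) \<in> tutte_zeros"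
proof -
  interpret weights q "realized q" "\<lambda>v. (q, v) \<in> tutte_zeros" using q by (intro weights_realized) auto
  obtain e where e: "0 < e"
    "\<And>w. \<bar>w + q\<bar> < e \<Longrightarrow>
      q * wZ q (8 + 2) (merge id 0 1) (plain_edges w petersen_minus) \<noteq>
        wZ q (8 + 2) id (plain_edges w petersen_minus) \<and>
      (q - 1) * wZ q (8 + 2) id (plain_edges w petersen_minus) /
        (q * wZ q (8 + 2) (merge id 0 1) (plain_edges w petersen_minus) -
         wZ q (8 + 2) id (plain_edges w petersen_minus)) < 0"
    using petersen_amplifies[OF q] by blast
  let ?T = "\<lambda>w. wZ q (8 + 2) id (plain_edges w petersen_minus)"
  let ?M = "\<lambda>w. wZ q (8 + 2) (merge id 0 1) (plain_edges w petersen_minus)"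
  define m where "m = 1 + q / l"
  have x: "0 < 1 + q / v \<and> 1 + q / v \<le> m" if v: "v \<in> {l..u}" for v
  proof -
    have "v < 0" "l < 0" using v q lu by auto
    moreover have "- 1 < q / v" using v q lu by (simp add: neg_less_divide_eq)
    moreover have "q / v \<le> q / l" using v q lu by (intro divide_left_mono) (auto intro: mult_neg_neg)
    ultimately show ?thesis by (simp add: m_def)
  qed
  have m1: "m < 1" using q lu by (simp add: m_def divide_pos_neg)
  have m0: "0 < m" using x[of l] lu by auto
  \<comment> \<open>For \<open>t < d\<close> the weight \<open>q / (t - 1)\<close> differs from
    \<open>- q\<close> by \<open>q * t / (1 - t)\<close>, which is at most \<open>2 * q * t\<close>
    because of the bound 1/2.\<close>
  define d where "d = min (1 / 2) (e / (2 * q))"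
  have d: "0 < d" "d \<le> 1 / 2" "2 * q * d \<le> e" using e(1) q by (auto simp: d_def min_def field_simps)
  obtain N where N: "m ^ N < d" using real_arch_pow_inv[OF d(1) m1] by blast
  have R: "realized q l u (\<lambda>v. 1 + q / v) (\<lambda>v. 1 + v)" using q lu by (intro realized_edge) auto
  have RN: "realized q l u (\<lambda>v. (1 + q / v) ^ Suc N) (\<lambda>v. 1 + q / ((1 + q / v) ^ Suc N - 1))"
    using x m1 by (intro ser_power[OF R]) force+
  have small: "\<bar>1 + q / ((1 + q / v) ^ Suc N - 1) - 1 + q\<bar> < e" if v: "v \<in> {l..u}" for v
  proof -
    define t where "t = (1 + q / v) ^ Suc N"
    have t0: "0 < t" unfolding t_def using x[OF v] by (intro zero_less_power) auto
    have "t \<le> m ^ Suc N" unfolding t_def using x[OF v] by (intro power_mono) auto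
    also have "\<dots> \<le> m ^ N" using m0 m1 by (intro power_decreasing) auto
    finally have td: "t < d" using N by simp
    have t1: "t \<le> 1 / 2" using td d by linarith
    define r where "r = q * t / (1 - t)"
    have "1 + q / (t - 1) - 1 + q = - r" using t1 by (simp add: r_def divide_simps) algebra
    moreover have "r \<le> 2 * q * t"
      using frac_le[of "q * t" "q * t" "1 / 2" "1 - t"] t0 t1 q by (simp add: r_def)
    moreover have "0 \<le> r" using t0 t1 q by (simp add: r_def)
    moreover have "2 * q * t < 2 * q * d" using td q by simp
    ultimately have "\<bar>1 + q / (t - 1) - 1 + q\<bar> < e" using d(3) by linarith
    then show ?thesis unfolding t_def .
  qed
  have ne: "?T w \<noteq> ?M w \<and> q * ?M w \<noteq> ?T w" if "\<bar>w + q\<bar> < e" for w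
  proof -
    have False if eq: "?T w = ?M w"
    proof -
      note * = e(2)[OF \<open>\<bar>w + q\<bar> < e\<close>]
      have "(q - 1) * ?T w = q * ?M w - ?T w" using eq by (simp add: algebra_simps)
      then have "(q - 1) * ?T w / (q * ?M w - ?T w) = 1"
        using *[THEN conjunct1] by (simp only: divide_self right_minus_eq not_False_eq_True)
      then show False using * by linarith
    qed
    then show ?thesis using e(2)[OF that] by blast
  qed
  note R' = realized_uniform[OF RN petersen_below _ _ ne[OF small]]
  show ?thesis
    by (rule root_with_partner[OF R _ _ R']) (use q lu e(2)[OF small] in auto)
qed

subsection \<open>Density\<close>

lemma dense_in_regionI:
  fixes S Rg :: "(real \<times> real) set"
  assumes "\<And>q v e. (q, v) \<in> Rg \<Longrightarrow> 0 < e \<Longrightarrow>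
    \<exists>q' v'. \<bar>q' - q\<bar> < e \<and> \<bar>v' - v\<bar> < e \<and> (q', v') \<in> Rg \<and> (q', v') \<in> S"
  shows "dense_in_region S Rg"
  unfolding dense_in_region_def
proof clarify
  fix q v assume qv: "(q, v) \<in> Rg"
  show "(q, v) \<in> closure (S \<inter> Rg)"
    unfolding closure_approachable
  proof (intro allI impI)
    fix e :: real assume "0 < e"
    then obtain q' v' where *: "\<bar>q' - q\<bar> < e / 2" "\<bar>v' - v\<bar> < e / 2" "(q', v') \<in> Rg" "(q', v') \<in> S"
      using assms[OF qv, of "e / 2"] by auto
    have "dist (q', v') (q, v) \<le> \<bar>q' - q\<bar> + \<bar>v' - v\<bar>"
      unfolding dist_Pair_Pair dist_real_def by (rule sqrt_sum_squares_le_sum_abs[THEN order_trans]) simp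
    with * show "\<exists>y\<in>S \<inter> Rg. dist y (q, v) < e"
      by (intro bexI[of _ "(q', v')"]) auto
  qed
qed

lemma non_integer_near:
  fixes q e :: real
  assumes "0 < e"
  obtains q' where "q - e < q'" "q' < q" "q' \<notin> \<int>"
proof -
  \<comment> \<open>The largest integer below \<open>q\<close>; no integer lies strictly between the
    two.\<close>
  define n where "n = \<lceil>q\<rceil> - 1"
  have n: "of_int n < q" "q \<le> of_int n + 1" by (simp_all add: n_def) linarith+
  define q' where "q' = max (q - e / 2) ((of_int n + q) / 2)"
  have q': "q - e < q'" "q' < q" "of_int n < q'" using assms n by (auto simp: q'_def less_max_iff_disj)
  have "q' \<notin> \<int>"
  proof
    assume "q' \<in> \<int>"
    then obtain m where "q' = of_int m" by (elim Ints_cases)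
    then show False using q' n by simp
  qed
  then show ?thesis using that q' by blast
qed

text \<open>A box around the point leaves room to move \<open>q\<close> down to a non-integer and to
  find a zero on a short vertical segment.\<close>

lemma dense_in_open_region:
  assumes op: "open Rg"
    and zero: "\<And>q l u. q \<notin> \<int> \<Longrightarrow> l < u \<Longrightarrow> (\<And>v. v \<in> {l..u} \<Longrightarrow> (q, v) \<in> Rg) \<Longrightarrow>
      \<exists>v\<in>{l..u}. (q, v) \<in> S"
  shows "dense_in_region S (Rg :: (real \<times> real) set)"
proof (rule dense_in_regionI)
  fix q v e :: real assume qv: "(q, v) \<in> Rg" and e: "0 < e"
  obtain A B where AB: "open A" "open B" "(q, v) \<in> A \<times> B" "A \<times> B \<subseteq> Rg"
    using open_prod_elim[OF op qv] by blast
  obtain d1 where d1: "0 < d1" "\<And>x. \<bar>x - q\<bar> < d1 \<Longrightarrow> x \<in> A"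
    using AB(1,3) unfolding open_dist dist_real_def by blast
  obtain d2 where d2: "0 < d2" "\<And>x. \<bar>x - v\<bar> < d2 \<Longrightarrow> x \<in> B"
    using AB(2,3) unfolding open_dist dist_real_def by blast
  obtain q' where q': "q - min d1 e < q'" "q' < q" "q' \<notin> \<int>"
    using non_integer_near[of "min d1 e" q] d1(1) e by auto
  define u where "u = v + min d2 e / 2"
  have u: "v < u" "u < v + d2" "u < v + e" using d2(1) e by (auto simp: u_def)
  have box: "(q', v') \<in> Rg" if "v' \<in> {v..u}" for v'
    using AB(4) d1(2)[of q'] d2(2)[of v'] q' u that by auto
  obtain v' where "v' \<in> {v..u}" "(q', v') \<in> S" using zero[OF q'(3) u(1) box] by blast
  then show "\<exists>q' v'. \<bar>q' - q\<bar> < e \<and> \<bar>v' - v\<bar> < e \<and> (q', v') \<in> Rg \<and> (q', v') \<in> S"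
    using box q' u by (intro exI[of _ q'] exI[of _ v']) auto
qed

section \<open>The cubic of the diamond curve\<close>

lemma diamond_cubic_neg:
  assumes "0 < q" "q \<le> 32 / 27" "v_diamond_plus q < t" "t < 0"
  shows "t ^ 3 - 2 * q * t - q\<^sup>2 < 0"
proof -
  obtain a b c where f: "diamond_poly q = [:- a, 1:] * ([:- b, 1:] * [:- c, 1:])"
    "a \<le> b" "b < 0" "0 < c"
    using diamond_poly_factor[OF assms(1,2)] .
  have "v_diamond_plus q = b"
    using f by (intro v_diamond_plus_eqI[of q a b c]) auto
  \<comment> \<open>Between the roots \<open>b\<close> and \<open>c\<close> only the last factor is
    negative.\<close>
  then have "(t - a) * ((t - b) * (t - c)) < 0"
    using f assms(3,4) by (intro mult_pos_neg mult_pos_neg) auto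
  moreover have "poly (diamond_poly q) t = (t - a) * ((t - b) * (t - c))"
    unfolding f(1) poly_mult by simp
  moreover have "poly (diamond_poly q) t = t ^ 3 - 2 * q * t - q\<^sup>2"
    by (simp add: diamond_poly_def power2_eq_square power3_eq_cube algebra_simps)
  ultimately show ?thesis by simp
qed

lemma diamond_plus_less:
  assumes "0 < q" "q \<le> 32 / 27" "\<And>t. w \<le> t \<Longrightarrow> t < 0 \<Longrightarrow> t ^ 3 - 2 * q * t - q\<^sup>2 < 0"
  shows "v_diamond_plus q < w"
proof (rule ccontr)
  assume "\<not> ?thesis"
  then show False
    using assms(3)[of "v_diamond_plus q"] v_diamond_plus_root[OF assms(1,2)] by simp
qed

text \<open>On the negative axis the cubic is largest at \<open>- s\<close>, where
  \<open>s\<^sup>2 = 2 * q / 3\<close>; its value \<open>2 * s ^ 3 - q\<^sup>2\<close> there is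
  negative exactly for \<open>q > 32 / 27\<close>.\<close>

lemma cubic_neg_large_q:
  assumes "32 / 27 < q" "t < (0::real)"
  shows "t ^ 3 - 2 * q * t - q\<^sup>2 < 0"
proof -
  define s where "s = sqrt (2 * q / 3)"
  have s: "0 < s" "s\<^sup>2 = 2 * q / 3" using assms by (auto simp: s_def)
  have "0 \<le> (- t - s)\<^sup>2 * (- t + 2 * s)" using s assms by (intro mult_nonneg_nonneg) auto
  also have "\<dots> = - (t ^ 3) + 3 * s\<^sup>2 * t + 2 * s ^ 3" by algebra
  finally have 1: "t ^ 3 - 2 * q * t \<le> 2 * s ^ 3" using s by simp
  have "(2 * s ^ 3)\<^sup>2 = 4 * (s\<^sup>2) ^ 3" by algebra
  also have "\<dots> = q ^ 3 * (32 / 27)" unfolding s(2) by (simp add: power_divide power_mult_distrib)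
  also have "\<dots> < q ^ 3 * q" using assms by (intro mult_strict_left_mono) auto
  also have "\<dots> = (q\<^sup>2)\<^sup>2" by algebra
  finally have "2 * s ^ 3 < q\<^sup>2" by (rule power2_less_imp_less) simp
  with 1 show ?thesis by simp
qed

text \<open>The cubic has a negative maximum on the compact interval, and lowering \<open>q\<close>
  to \<open>q'\<close> raises it by at most \<open>(q - q') * (2 * q)\<close>.\<close>

lemma cubic_neg_perturb:
  assumes q: "0 < q" "w < 0" and neg: "\<And>t. w \<le> t \<Longrightarrow> t < 0 \<Longrightarrow> t ^ 3 - 2 * q * t - q\<^sup>2 < (0::real)"
  obtains d where "0 < d"
    "\<And>q' t. q - d < q' \<Longrightarrow> q' < q \<Longrightarrow> 0 < q' \<Longrightarrow> w \<le> t \<Longrightarrow> t < 0 \<Longrightarrow> t ^ 3 - 2 * q' * t - q'\<^sup>2 < 0"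
proof -
  let ?f = "\<lambda>t. t ^ 3 - 2 * q * t - q\<^sup>2"
  have "continuous_on {w..0} ?f" by (intro continuous_intros)
  then obtain m where m: "m \<in> {w..0}" "\<And>t. t \<in> {w..0} \<Longrightarrow> ?f t \<le> ?f m"
    using continuous_attains_sup[of "{w..0}" ?f] q by auto
  have fm: "?f m < 0" using neg[of m] m(1) q by (cases "m = 0") auto
  show ?thesis
  proof (rule that[of "- ?f m / (2 * q)"])
    show "0 < - ?f m / (2 * q)" using fm q by (intro divide_pos_pos) auto
    fix q' t assume *: "q - - ?f m / (2 * q) < q'" "q' < q" "0 < q'" "w \<le> t" "t < 0"
    have "(q - q') * (2 * t + q + q') \<le> (q - q') * (2 * q)" using * by (intro mult_left_mono) auto
    also have "\<dots> < - ?f m" using * q by (simp add: field_simps)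
    finally have "(q - q') * (2 * t + q + q') < - ?f m" .
    moreover have "t ^ 3 - 2 * q' * t - q'\<^sup>2 = ?f t + (q - q') * (2 * t + q + q')" by algebra
    ultimately show "t ^ 3 - 2 * q' * t - q'\<^sup>2 < 0" using m(2)[of t] * by simp
  qed
qed

text \<open>The region contains points with \<open>q = 32 / 27\<close>, so \<open>q\<close> is moved
  only downwards. The cubic stays negative from \<open>v\<close> to 0, which keeps the zero inside
  the region.\<close>

lemma dense_above_diamond:
  "dense_in_region tutte_zeros {(q, v). 0 < q \<and> q \<le> 32 / 27 \<and> v_diamond_plus q < v \<and> v < 0}"
proof (rule dense_in_regionI, clarify)
  fix q v e :: real
  assume q: "0 < q" "q \<le> 32 / 27" and v: "v_diamond_plus q < v" "v < 0" and e: "0 < e"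
  obtain d where d: "0 < d"
    "\<And>q' t. q - d < q' \<Longrightarrow> q' < q \<Longrightarrow> 0 < q' \<Longrightarrow> v \<le> t \<Longrightarrow> t < 0 \<Longrightarrow> t ^ 3 - 2 * q' * t - q'\<^sup>2 < 0"
    by (rule cubic_neg_perturb[of q v]) (use q v diamond_cubic_neg in force)+
  obtain q' where q': "q - min d (min e q) < q'" "q' < q" "q' \<notin> \<int>"
    using non_integer_near[of "min d (min e q)" q] d(1) e q by auto
  have q1: "0 < q'" "q' \<noteq> 1" using q' by auto
  define u where "u = min (v + e / 2) (v / 2)"
  have u: "v < u" "u < v + e" "u < 0" using v e by (auto simp: u_def)
  have neg: "t ^ 3 - 2 * q' * t - q'\<^sup>2 < 0" if "v \<le> t" "t < 0" for t
    using d(2) q' q1 that by auto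
  obtain v' where v': "v' \<in> {v..u}" "(q', v') \<in> tutte_zeros"
    using zero_diamond[of q' v u] neg q q' q1 u by auto
  have "v_diamond_plus q' < v" using q q' q1 neg by (intro diamond_plus_less) auto
  then show "\<exists>q' v'. \<bar>q' - q\<bar> < e \<and> \<bar>v' - v\<bar> < e \<and>
      (q', v') \<in> {(q, v). 0 < q \<and> q \<le> 32 / 27 \<and> v_diamond_plus q < v \<and> v < 0} \<and> (q', v') \<in> tutte_zeros"
    using v' u q q' q1 by (intro exI[of _ q'] exI[of _ v']) auto
qed

lemma dense_below_diamond:
  "dense_in_region tutte_zeros {(q, v). 0 < q \<and> q \<le> 32 / 27 \<and> v < v_diamond_minus q}"
proof (rule dense_in_regionI, clarify)
  fix q v e :: real
  assume q: "0 < q" "q \<le> 32 / 27" and v: "v < v_diamond_minus q" and e: "0 < e"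
  \<comment> \<open>In the coordinate \<open>q / v\<close> the region lies above the middle branch,
    so the same perturbation applies.\<close>
  have minus_iff: "v < v_diamond_minus q \<longleftrightarrow> v < 0 \<and> v_diamond_plus q < q / v"
    if q: "0 < q" "q \<le> 32 / 27" for q v
  proof -
    have b: "v_diamond_plus q < 0" using v_diamond_plus_root[OF q] by simp
    then have neg: "v_diamond_minus q < 0" unfolding v_diamond_minus_def using q by (intro divide_pos_neg)
    have "v < v_diamond_minus q \<longleftrightarrow> q < v * v_diamond_plus q"
      unfolding v_diamond_minus_def using b by (simp add: neg_less_divide_eq)
    moreover have "v_diamond_plus q < q / v \<longleftrightarrow> q < v * v_diamond_plus q" if "v < 0"
      using that by (simp add: neg_less_divide_eq mult.commute)
    ultimately show ?thesis using neg by auto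
  qed
  define w where "w = q / v"
  have v0: "v < 0" and w: "v_diamond_plus q < w" using minus_iff[OF q] v by (auto simp: w_def)
  have w0: "w < 0" using q v0 by (simp add: w_def divide_pos_neg)
  obtain d where d: "0 < d"
    "\<And>q' t. q - d < q' \<Longrightarrow> q' < q \<Longrightarrow> 0 < q' \<Longrightarrow> w \<le> t \<Longrightarrow> t < 0 \<Longrightarrow> t ^ 3 - 2 * q' * t - q'\<^sup>2 < 0"
    by (rule cubic_neg_perturb[of q w]) (use q w w0 diamond_cubic_neg in force)+
  obtain q' where q': "q - min d (min e q) < q'" "q' < q" "q' \<notin> \<int>"
    using non_integer_near[of "min d (min e q)" q] d(1) e q by auto
  have q1: "0 < q'" "q' \<noteq> 1" using q' by auto
  have neg: "t ^ 3 - 2 * q' * t - q'\<^sup>2 < 0" if "w \<le> t" "t < 0" for t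
    using d(2) q' q1 that by auto
  have "w < q' / v" unfolding w_def using q' v0 by (simp add: divide_strict_right_mono_neg)
  \<comment> \<open>Going down from \<open>v\<close> can only increase \<open>q' / v'\<close>, which
    therefore stays above \<open>w\<close>.\<close>
  then obtain v' where v': "v' \<in> {v - e / 2..v}" "(q', v') \<in> tutte_zeros"
    using zero_dual_diamond[of q' "v - e / 2" v w] neg q q' q1 v0 e by auto
  have "v_diamond_plus q' < w" using q q' q1 neg by (intro diamond_plus_less) auto
  moreover have "q' / v \<le> q' / v'"
    using v' v0 q1 by (intro divide_left_mono) (auto intro: mult_neg_neg)
  ultimately have "v' < v_diamond_minus q'"
    using minus_iff[of q' v'] \<open>w < q' / v\<close> q q' q1 v' v0 by auto
  then show "\<exists>q' v'. \<bar>q' - q\<bar> < e \<and> \<bar>v' - v\<bar> < e \<and>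
      (q', v') \<in> {(q, v). 0 < q \<and> q \<le> 32 / 27 \<and> v < v_diamond_minus q} \<and> (q', v') \<in> tutte_zeros"
    using v' q q' q1 e by (intro exI[of _ q'] exI[of _ v']) auto
qed

lemma zero_antiferromagnetic:
  assumes q: "2 < q" "q \<notin> \<int>" and lu: "l < u" "u < 0" and reg: "q < 4 \<or> - q < l"
  shows "\<exists>v\<in>{l..u}. (q, v) \<in> tutte_zeros"
proof -
  have q3: "q \<noteq> 3" using q by auto
  \<comment> \<open>The three ranges belong to near-cliques, single edges and the Petersen graph; in
    the last one \<open>reg\<close> forces \<open>q < 4\<close>. Segments are shortened to lie
    strictly inside their range.\<close>
  consider "-2 < u" | "u \<le> -2" "- q < u" | "u \<le> - q" using q by linarith
  then show ?thesis
  proof cases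
    case 1
    then have "\<exists>v\<in>{max l ((u - 2) / 2)..u}. (q, v) \<in> tutte_zeros"
      using q lu by (intro zero_clique) (auto simp: less_max_iff_disj)
    then show ?thesis by auto
  next
    case 2
    define l' where "l' = max l ((u - q) / 2)"
    have "l' < u" "- q < l'" "l \<le> l'" using 2 lu by (auto simp: l'_def less_max_iff_disj)
    then have "\<exists>v\<in>{l'..(l' + u) / 2}. (q, v) \<in> tutte_zeros"
      using q 2 by (intro zero_between) auto
    then show ?thesis using \<open>l' < u\<close> \<open>l \<le> l'\<close> by force
  next
    case 3
    then have "\<exists>v\<in>{l..(l + u) / 2}. (q, v) \<in> tutte_zeros"
      using q q3 lu reg by (intro zero_petersen) auto
    then show ?thesis using lu by force
  qed
qed

theorem theorem1p2:
  shows "dense_in_region tutte_zeros {(q, v). q < 0 \<and> v < - 2} \<and>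
         dense_in_region tutte_zeros {(q, v). q < 0 \<and> 0 < v \<and> v < - q / 2} \<and>
         dense_in_region tutte_zeros {(q, v). 0 < q \<and> q \<le> 32 / 27 \<and> v < v_diamond_minus q} \<and>
         dense_in_region tutte_zeros {(q, v). 0 < q \<and> q \<le> 32 / 27 \<and> v_diamond_plus q < v \<and> v < 0} \<and>
         dense_in_region tutte_zeros {(q, v). 32 / 27 < q \<and> q < 4 \<and> v < 0} \<and>
         dense_in_region tutte_zeros {(q, v). 4 < q \<and> - q < v \<and> v < 0}"
proof (intro conjI)
  note op = open_Collect_conj open_Collect_less continuous_intros
  show "dense_in_region tutte_zeros {(q, v). q < 0 \<and> v < - 2}"
  proof (rule dense_in_open_region)
    show "open {(q::real, v). q < 0 \<and> v < (- 2::real)}"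
      unfolding case_prod_beta by (intro op)
    fix q l u :: real assume "q \<notin> \<int>" "l < u" "\<And>v. v \<in> {l..u} \<Longrightarrow> (q, v) \<in> {(q, v). q < 0 \<and> v < - 2}"
    from this(2) this(3)[of u] show "\<exists>v\<in>{l..u}. (q, v) \<in> tutte_zeros"
      by (intro zero_beyond_2) auto
  qed
  show "dense_in_region tutte_zeros {(q, v). q < 0 \<and> 0 < v \<and> v < - q / 2}"
  proof (rule dense_in_open_region)
    show "open {(q::real, v). q < 0 \<and> 0 < v \<and> v < - q / (2::real)}"
      unfolding case_prod_beta by (intro op) auto
    fix q l u :: real assume "q \<notin> \<int>" "l < u"
      "\<And>v. v \<in> {l..u} \<Longrightarrow> (q, v) \<in> {(q, v). q < 0 \<and> 0 < v \<and> v < - q / 2}"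
    from this(2) this(3)[of l] this(3)[of u] show "\<exists>v\<in>{l..u}. (q, v) \<in> tutte_zeros"
      by (intro zero_ferromagnetic) auto
  qed
  show "dense_in_region tutte_zeros {(q, v). 32 / 27 < q \<and> q < 4 \<and> v < 0}"
  proof (rule dense_in_open_region)
    show "open {(q::real, v). 32 / 27 < q \<and> q < 4 \<and> v < (0::real)}"
      unfolding case_prod_beta by (intro op)
    fix q l u :: real assume *: "q \<notin> \<int>" "l < u"
      "\<And>v. v \<in> {l..u} \<Longrightarrow> (q, v) \<in> {(q, v). 32 / 27 < q \<and> q < 4 \<and> v < 0}"
    have qu: "32 / 27 < q" "q < 4" "u < 0" using *(2) *(3)[of u] by auto
    have "q \<noteq> 1" "q \<noteq> 2" using *(1) by auto
    \<comment> \<open>For \<open>q < 2\<close> the cubic is negative at every negative weight, so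
      the diamond iteration covers all \<open>v < 0\<close>.\<close>
    then show "\<exists>v\<in>{l..u}. (q, v) \<in> tutte_zeros"
      using zero_diamond[of q l u] zero_antiferromagnetic[of q l u] cubic_neg_large_q[OF qu(1)] * qu
      by (cases "q < 2") auto
  qed
  show "dense_in_region tutte_zeros {(q, v). 4 < q \<and> - q < v \<and> v < 0}"
  proof (rule dense_in_open_region)
    show "open {(q::real, v). 4 < q \<and> - q < v \<and> v < (0::real)}"
      unfolding case_prod_beta by (intro op)
    fix q l u :: real assume "q \<notin> \<int>" "l < u"
      "\<And>v. v \<in> {l..u} \<Longrightarrow> (q, v) \<in> {(q, v). 4 < q \<and> - q < v \<and> v < 0}"
    from this(1,2) this(3)[of l] this(3)[of u] show "\<exists>v\<in>{l..u}. (q, v) \<in> tutte_zeros"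
      by (intro zero_antiferromagnetic) auto
  qed
qed (rule dense_below_diamond dense_above_diamond)+

end
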